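(* Let $d, D, M$ be positive integers. (a) For all $d\ge 1$, we have $p_{\mathrm c}(d,d+1,2)<1$, and hence $M_{\mathrm c}(d,d+1)\le 2$. (b) For all $D\ge 2$, we have $p_{\mathrm c}(2,D,1)=1$, and hence $M_{\mathrm c}(2,D)>1$. (c) For all $d\ge 2$ and all $M\ge 1$, we have $p_{\mathrm c}(d,d,M)=1$, and hence $M_{\mathrm c}(d,d)=\infty$.
   Context: $\mathbb{Z}^d$ is the $d$-dimensional integer lattice, its elements are called sites, and $\|\cdot\|=\|\cdot\|_1$ denotes the $\ell^1$-norm. A map $f:\mathbb{Z}^d\to\mathbb{Z}^D$ is $M$-Lipschitz ($M$-Lip) if $\|f(x)-f(y)\|\le M$ for all $x,y\in\mathbb{Z}^d$ with $\|x-y\|=1$. Site percolation: for $p\in[0,1]$, each site of $\mathbb{Z}^D$ is declared open with probability $p$ and otherwise closed, independently for different sites. $W_p(\mathbb{Z}^D)$ is the random set of open sites and $\mathbb{P}_p$ is the associated (product) probability measure. Define $$L(d,D,M,p):=\mathbb{P}_p\bigl(\text{there exists an } M\text{-Lip injection from } \mathbb{Z}^d \text{ to } W_p(\mathbb{Z}^D)\bigr),$$ which takes values in $\{0,1\}$ and is increasing in $p$. Define $$p_{\mathrm c}(d,D,M):=\inf\{p\in[0,1]: L(d,D,M,p)=1\},$$ $$M_{\mathrm c}(d,D):=\min\{M\ge 1 \text{ integer}: p_{\mathrm c}(d,D,M)<1\},$$ with the convention $\min\varnothing:=\infty$. *)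

theory Defs
  imports "HOL-Probability.Probability" "HOL-Library.Extended_Nat"
begin

definition sites :: "nat \<Rightarrow> (nat \<Rightarrow> int) set" where
  "sites d = {..<d} \<rightarrow>\<^sub>E (UNIV :: int set)"

definition l1_norm :: "nat \<Rightarrow> (nat \<Rightarrow> int) \<Rightarrow> int" where
  "l1_norm d x = (\<Sum>i<d. \<bar>x i\<bar>)"

definition lip :: "nat \<Rightarrow> nat \<Rightarrow> nat \<Rightarrow> ((nat \<Rightarrow> int) \<Rightarrow> (nat \<Rightarrow> int)) \<Rightarrow> bool" where
  "lip d D M f \<longleftrightarrow> f \<in> sites d \<rightarrow> sites D \<and>
     (\<forall>x\<in>sites d. \<forall>y\<in>sites d. l1_norm d (\<lambda>i. x i - y i) = 1 \<longrightarrow>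
        l1_norm D (\<lambda>i. f x i - f y i) \<le> int M)"

definition percolation :: "nat \<Rightarrow> real \<Rightarrow> ((nat \<Rightarrow> int) \<Rightarrow> bool) measure" where
  "percolation D p = (\<Pi>\<^sub>M x\<in>sites D. measure_pmf (bernoulli_pmf p))"

definition open_sites :: "nat \<Rightarrow> ((nat \<Rightarrow> int) \<Rightarrow> bool) \<Rightarrow> (nat \<Rightarrow> int) set" where
  "open_sites D \<omega> = {x \<in> sites D. \<omega> x}"

text \<open>
  The event below is measurable, so that \<open>measure\<close> is not applied outside its domain: by
  compactness it holds iff for some site \<open>y\<close> and every \<open>n\<close> the box \<open>{-n..n}\<close> to the power \<open>d\<close>
  has an \<open>M\<close>-Lipschitz injection into the open sites sending the origin to \<open>y\<close>, and for given
  \<open>y\<close> and \<open>n\<close> this depends on finitely many sites only.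
\<close>

definition lip_prob :: "nat \<Rightarrow> nat \<Rightarrow> nat \<Rightarrow> real \<Rightarrow> real" where
  "lip_prob d D M p = measure (percolation D p)
     {\<omega> \<in> space (percolation D p).
        \<exists>f. lip d D M f \<and> inj_on f (sites d) \<and> f ` sites d \<subseteq> open_sites D \<omega>}"

text \<open>
  The infimum is taken in the extended reals, so that the infimum of the empty set (which occurs,
  for instance, if \<open>D < d\<close>) is \<open>\<infinity>\<close> rather than an unspecified real.
\<close>

definition p_crit :: "nat \<Rightarrow> nat \<Rightarrow> nat \<Rightarrow> ereal" where
  "p_crit d D M = (INF p \<in> {p \<in> {0..1}. lip_prob d D M p = 1}. ereal p)"

text \<open>The infimum in \<^typ>\<open>enat\<close> is the minimum of a nonempty set, and \<open>\<infinity>\<close> for the empty set.\<close>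

definition M_crit :: "nat \<Rightarrow> nat \<Rightarrow> enat" where
  "M_crit d D = (INF M \<in> {M. 1 \<le> M \<and> p_crit d D M < 1}. enat M)"

end

theory Submission imports Defs begin

text \<open>
  All three parts come down to whether the probability of an embedding is 0 or 1 at certain \<open>p\<close>.
  That value is an honest probability because the event is measurable
  (\<open>embedding_event_measurable\<close>), which follows from compactness: an embedding with a given
  image of the origin exists as soon as every finite set of sites can be embedded.

  \<^bold>\<open>One extra dimension, Lipschitz constant 2.\<close> Call a site reached if it can be reached from the
  half-space of height at most 0 by upward steps onto closed sites and by free steps that lose one
  unit of height while moving at most one unit sideways. A path to height \<open>h\<close> with \<open>n\<close> steps lands on
  at least \<open>(n + h) / 2\<close> closed sites, so if closed sites are rare a union bound over paths shows
  that almost surely every column contains unreached sites. The lowest unreached site of a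
  column is open, as otherwise one could step up onto it, and the free steps make its height a
  1-Lipschitz function of the column. The graph of this function is a 2-Lipschitz embedding
  (\<open>embedding_of_bounded_reach\<close>, \<open>lip_prob_eq_1_codim_1\<close>).

  \<^bold>\<open>Lipschitz constant 1 in the plane.\<close> A 1-Lipschitz injection maps unit squares to unit squares, so
  opposite edges of a square have the same image vector and \<open>f (i, j) = f (i, 0) + f (0, j) - f (0, 0)\<close>
  (\<open>one_lip_injection_splits\<close>). Thus \<open>f\<close> on an \<open>n\<close> by \<open>n\<close> square is described by two paths, that is
  by \<open>exp (O (n log n))\<close> choices, while each choice requires about \<open>n\<^sup>2\<close> distinct open sites
  (\<open>lip_prob_eq_0_plane\<close>).

  \<^bold>\<open>Equal dimensions.\<close> If \<open>p < 1\<close>, large regions of the lattice can be cut into cubes of side \<open>K\<close> each of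
  which contains a hole, a completely closed cube of a fixed radius \<open>r\<close>. The radial projection away
  from the holes retracts the open sites to the union of the boundaries of the cubes. This union has
  dimension \<open>d - 1\<close>, so it can be coloured with \<open>d\<close> colours such that the components of each colour
  are confined to a bounded number of cubes, even if components are taken with respect to jumps of a
  bounded size \<open>R\<close>; that \<open>r\<close> is a large multiple of \<open>R\<close> pays for the expansion of the radial
  projection near the holes (\<open>perforated_lattice_colouring\<close>). Pull this colouring back along an
  embedding to a box of side \<open>n\<close>. A \<open>d\<close>-dimensional box coloured with \<open>d\<close> colours has a
  monochromatic crossing (\<open>monochromatic_crossing\<close>, a form of the Lebesgue covering theorem or
  of the theorem that Hex has no draws), which contains order \<open>n\<close> sites. They are mapped
  injectively into a single component with at most \<open>(3 K + 1)\<^sup>d\<close> sites, a contradiction if \<open>n\<close>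
  exceeds a fixed multiple of this number (\<open>no_embedding_among_holes\<close>). Such an \<open>n\<close> is
  polynomial in \<open>K\<close>, whereas the probability that a given cube has no hole decays exponentially in
  \<open>K\<close>, so the required holes are present with probability tending to 1
  (\<open>lip_prob_eq_0_equal_dims\<close>).
\<close>

section \<open>Sites and Lipschitz maps\<close>

lemma countable_sites: "countable (sites D)"
  unfolding sites_def by (intro countable_PiE) auto

lemma l1_norm_nonneg: "0 \<le> l1_norm d x"
  unfolding l1_norm_def by (intro sum_nonneg) auto

lemma l1_norm_component_le:
  assumes "i < d" shows "\<bar>x i\<bar> \<le> l1_norm d x"
  unfolding l1_norm_def using assms by (intro member_le_sum) auto

lemma l1_norm_triangle:
  "l1_norm d (\<lambda>i. x i - z i) \<le> l1_norm d (\<lambda>i. x i - y i) + l1_norm d (\<lambda>i. y i - z i)"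
  unfolding l1_norm_def sum.distrib[symmetric] by (intro sum_mono) auto

lemma sites_eqI:
  assumes "x \<in> sites d" "y \<in> sites d" "\<And>i. i < d \<Longrightarrow> x i = y i"
  shows "x = y"
  using assms unfolding sites_def by (intro PiE_ext) auto

lemma sites_update:
  assumes "x \<in> sites d" "i < d" shows "x(i := t) \<in> sites d"
  using assms unfolding sites_def by (auto simp: PiE_def extensional_def)

lemma sum_update_less:
  fixes g :: "nat \<Rightarrow> int \<Rightarrow> 'b::ab_group_add"
  assumes "i < d"
  shows "(\<Sum>j<d. g j ((x(i := t)) j)) = (\<Sum>j<d. g j (x j)) - g i (x i) + g i t"
proof -
  have "(\<Sum>j<d. g j ((x(i := t)) j)) = g i t + (\<Sum>j\<in>{..<d} - {i}. g j ((x(i := t)) j))"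
    using assms by (subst sum.remove[of _ i]) auto
  also have "(\<Sum>j\<in>{..<d} - {i}. g j ((x(i := t)) j)) = (\<Sum>j\<in>{..<d} - {i}. g j (x j))"
    by (intro sum.cong) auto
  also have "\<dots> = (\<Sum>j<d. g j (x j)) - g i (x i)"
    using assms by (subst sum.remove[of "{..<d}" i]) auto
  finally show ?thesis by (simp add: algebra_simps)
qed

lemma lip_bound:
  assumes f: "lip d D M f" and x: "x \<in> sites d" and y: "y \<in> sites d"
  shows "l1_norm D (\<lambda>i. f x i - f y i) \<le> int M * l1_norm d (\<lambda>i. x i - y i)"
  using x
proof (induction "nat (l1_norm d (\<lambda>i. x i - y i))" arbitrary: x rule: less_induct)
  case less
  show ?case
  proof (cases "\<forall>i<d. x i = y i")
    case True
    then have "x = y" using less.prems y by (intro sites_eqI) auto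
    then show ?thesis by (simp add: l1_norm_def)
  next
    case False
    then obtain i where i: "i < d" "x i \<noteq> y i" by auto
    define x' where "x' = x(i := x i + sgn (y i - x i))"
    have x': "x' \<in> sites d" unfolding x'_def by (rule sites_update[OF less.prems i(1)])
    have s: "\<bar>sgn (y i - x i)\<bar> = 1" "\<bar>x i + sgn (y i - x i) - y i\<bar> = \<bar>x i - y i\<bar> - 1"
      using i(2) by (auto simp: sgn_if)
    have 1: "l1_norm d (\<lambda>i. x i - x' i) = 1"
      unfolding l1_norm_def x'_def using sum_update_less[OF i(1), of "\<lambda>j t. \<bar>x j - t\<bar>" x] s
      by simp
    have 2: "l1_norm d (\<lambda>i. x' i - y i) = l1_norm d (\<lambda>i. x i - y i) - 1"
      unfolding l1_norm_def x'_def using sum_update_less[OF i(1), of "\<lambda>j t. \<bar>t - y j\<bar>" x] s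
      by simp
    have "nat (l1_norm d (\<lambda>i. x' i - y i)) < nat (l1_norm d (\<lambda>i. x i - y i))"
      using 2 l1_norm_nonneg[of d "\<lambda>i. x' i - y i"] by linarith
    from less.hyps[OF this x']
    have "l1_norm D (\<lambda>i. f x' i - f y i) \<le> int M * (l1_norm d (\<lambda>i. x i - y i) - 1)"
      by (simp add: 2)
    moreover have "l1_norm D (\<lambda>i. f x i - f x' i) \<le> int M"
      using f less.prems x' 1 unfolding lip_def by blast
    moreover have "l1_norm D (\<lambda>i. f x i - f y i)
        \<le> l1_norm D (\<lambda>i. f x i - f x' i) + l1_norm D (\<lambda>i. f x' i - f y i)"
      by (rule l1_norm_triangle)
    ultimately show ?thesis by (simp add: algebra_simps)
  qed
qed

definition cube :: "nat \<Rightarrow> (nat \<Rightarrow> int) \<Rightarrow> nat \<Rightarrow> (nat \<Rightarrow> int) set" where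
  "cube D v r = (\<Pi>\<^sub>E i\<in>{..<D}. {v i - int r .. v i + int r})"

lemma finite_cube: "finite (cube D v r)"
  unfolding cube_def by (auto intro: finite_PiE)

lemma card_cube: "card (cube D v r) = (2 * r + 1) ^ D"
  unfolding cube_def by (subst card_PiE) (auto simp: nat_add_distrib nat_mult_distrib)

lemma in_cubeI_sup:
  assumes "z \<in> sites D" "\<And>i. i < D \<Longrightarrow> \<bar>z i - v i\<bar> \<le> int r"
  shows "z \<in> cube D v r"
proof -
  have "z i \<in> {v i - int r .. v i + int r}" if "i < D" for i
    using assms(2)[OF that] by (auto simp: abs_le_iff)
  then show ?thesis using assms(1) unfolding cube_def sites_def by (auto simp: PiE_iff)
qed

lemma in_cubeI_l1:
  assumes "z \<in> sites D" "l1_norm D (\<lambda>i. z i - v i) \<le> int r"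
  shows "z \<in> cube D v r"
  using assms(1)
proof (rule in_cubeI_sup)
  show "\<bar>z i - v i\<bar> \<le> int r" if "i < D" for i
    using assms(2) l1_norm_component_le[OF that, of "\<lambda>i. z i - v i"] by linarith
qed

definition origin :: "nat \<Rightarrow> nat \<Rightarrow> int" where
  "origin d = (\<lambda>i\<in>{..<d}. 0)"

lemma origin_sites: "origin d \<in> sites d"
  unfolding origin_def sites_def by auto

section \<open>Finite-dimensional probabilities\<close>

lemma space_percolation: "space (percolation D p) = sites D \<rightarrow>\<^sub>E UNIV"
  unfolding percolation_def by (simp add: space_PiM)

lemma prob_space_percolation: "prob_space (percolation D p)"
  unfolding percolation_def by (intro prob_space_PiM measure_pmf.prob_space_axioms)

lemma percolation_event_measurable:
  assumes "x \<in> sites D"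
  shows "{\<omega> \<in> space (percolation D p). \<omega> x = b} \<in> sets (percolation D p)"
proof -
  have "(\<lambda>\<omega>. \<omega> x) \<in> percolation D p \<rightarrow>\<^sub>M measure_pmf (bernoulli_pmf p)"
    unfolding percolation_def using assms by measurable
  then have "(\<lambda>\<omega>. \<omega> x) -` {b} \<inter> space (percolation D p) \<in> sets (percolation D p)"
    by (rule measurable_sets) auto
  also have "(\<lambda>\<omega>. \<omega> x) -` {b} \<inter> space (percolation D p)
      = {\<omega> \<in> space (percolation D p). \<omega> x = b}" by auto
  finally show ?thesis .
qed

lemma percolation_all_measurable:
  assumes "A \<subseteq> sites D" "countable A"
  shows "{\<omega> \<in> space (percolation D p). \<forall>x\<in>A. \<omega> x = b} \<in> sets (percolation D p)"
proof (cases "A = {}")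
  case False
  have "{\<omega> \<in> space (percolation D p). \<forall>x\<in>A. \<omega> x = b}
      = (\<Inter>x\<in>A. {\<omega> \<in> space (percolation D p). \<omega> x = b})" using False by auto
  also have "\<dots> \<in> sets (percolation D p)"
    using assms False percolation_event_measurable by (intro sets.countable_INT') auto
  finally show ?thesis .
qed auto

lemma prob_all_equal:
  assumes p: "p \<in> {0..1}" and A: "A \<subseteq> sites D" "finite A"
  shows "measure (percolation D p) {\<omega> \<in> space (percolation D p). \<forall>x\<in>A. \<omega> x = b}
     = (if b then p else 1 - p) ^ card A"
proof -
  interpret product_prob_space "\<lambda>_. measure_pmf (bernoulli_pmf p)" "sites D"
    by (intro product_prob_spaceI measure_pmf.prob_space_axioms)
  have "{\<omega> \<in> space (percolation D p). \<forall>x\<in>A. \<omega> x = b}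
      = prod_emb (sites D) (\<lambda>_. measure_pmf (bernoulli_pmf p)) A (\<Pi>\<^sub>E x\<in>A. {b})"
  proof -
    have "restrict \<omega> A \<in> (\<Pi>\<^sub>E x\<in>A. {b}) \<longleftrightarrow> (\<forall>x\<in>A. \<omega> x = b)" for \<omega> :: "(nat \<Rightarrow> int) \<Rightarrow> bool"
      unfolding restrict_PiE_iff by auto
    then show ?thesis unfolding prod_emb_def space_percolation by (simp add: set_eq_iff conj_commute)
  qed
  then have "measure (percolation D p) {\<omega> \<in> space (percolation D p). \<forall>x\<in>A. \<omega> x = b}
     = (\<Prod>x\<in>A. measure (measure_pmf (bernoulli_pmf p)) {b})"
    unfolding percolation_def
    using measure_PiM_emb[OF A, of "\<lambda>_. {b}"] by (simp del: PiE_singleton prod_constant)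
  also have "\<dots> = (if b then p else 1 - p) ^ card A"
    using p by (simp add: measure_pmf_single)
  finally show ?thesis .
qed

lemma union_bound:
  fixes p :: real
  assumes fin: "finite \<A>" and p: "p \<in> {0..1}"
    and A: "\<And>A. A \<in> \<A> \<Longrightarrow> A \<subseteq> sites D \<and> finite A \<and> k \<le> card A"
  shows "{\<omega> \<in> space (percolation D p). \<exists>A\<in>\<A>. \<forall>x\<in>A. \<omega> x = b} \<in> sets (percolation D p)"
    "measure (percolation D p) {\<omega> \<in> space (percolation D p). \<exists>A\<in>\<A>. \<forall>x\<in>A. \<omega> x = b}
     \<le> card \<A> * (if b then p else 1 - p) ^ k"
proof -
  interpret P: prob_space "percolation D p" by (rule prob_space_percolation)
  let ?E = "\<lambda>A. {\<omega> \<in> space (percolation D p). \<forall>x\<in>A. \<omega> x = b}"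
  have E: "{\<omega> \<in> space (percolation D p). \<exists>A\<in>\<A>. \<forall>x\<in>A. \<omega> x = b} = (\<Union>A\<in>\<A>. ?E A)"
    by auto
  have m: "?E A \<in> sets (percolation D p)" if "A \<in> \<A>" for A
    using A[OF that] by (intro percolation_all_measurable) (auto intro: countable_finite)
  show "{\<omega> \<in> space (percolation D p). \<exists>A\<in>\<A>. \<forall>x\<in>A. \<omega> x = b} \<in> sets (percolation D p)"
    unfolding E using fin m by auto
  have "P.prob (\<Union>A\<in>\<A>. ?E A) \<le> (\<Sum>A\<in>\<A>. P.prob (?E A))"
    using fin m by (intro P.finite_measure_subadditive_finite) auto
  also have "\<dots> \<le> (\<Sum>A\<in>\<A>. (if b then p else 1 - p) ^ k)"
  proof (intro sum_mono)
    fix X assume X: "X \<in> \<A>"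
    have "P.prob (?E X) = (if b then p else 1 - p) ^ card X"
      using A[OF X] p by (intro prob_all_equal) auto
    also have "\<dots> \<le> (if b then p else 1 - p) ^ k"
      using A[OF X] p by (intro power_decreasing) auto
    finally show "P.prob (?E X) \<le> (if b then p else 1 - p) ^ k" .
  qed
  finally show "P.prob {\<omega> \<in> space (percolation D p). \<exists>A\<in>\<A>. \<forall>x\<in>A. \<omega> x = b}
     \<le> card \<A> * (if b then p else 1 - p) ^ k" unfolding E by simp
qed

text \<open>
  The set \<open>A\<close> is what makes the induction on \<open>m\<close> work: the event that the last hole fails is the
  difference of the same event for fewer holes with the set \<open>A\<close> and with \<open>A\<close> enlarged by the last
  hole. This replaces an appeal to independence of the events for disjoint sets of sites.
\<close>

lemma prob_closed_and_no_hole: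
  fixes H :: "nat \<Rightarrow> (nat \<Rightarrow> int) set"
  assumes p: "p \<in> {0..1}" and A: "A \<subseteq> sites D" "finite A"
    and H: "\<And>j. j < m \<Longrightarrow> H j \<subseteq> sites D \<and> finite (H j) \<and> card (H j) = k \<and> A \<inter> H j = {}"
    and disj: "disjoint_family_on H {..<m}"
  shows "{\<omega> \<in> space (percolation D p). (\<forall>x\<in>A. \<not> \<omega> x) \<and> (\<forall>j<m. \<exists>x\<in>H j. \<omega> x)}
      \<in> sets (percolation D p)"
    "measure (percolation D p)
       {\<omega> \<in> space (percolation D p). (\<forall>x\<in>A. \<not> \<omega> x) \<and> (\<forall>j<m. \<exists>x\<in>H j. \<omega> x)}
     = (1 - p) ^ card A * (1 - (1 - p) ^ k) ^ m"
proof -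
  interpret P: prob_space "percolation D p" by (rule prob_space_percolation)
  let ?E = "\<lambda>A m. {\<omega> \<in> space (percolation D p). (\<forall>x\<in>A. \<not> \<omega> x) \<and> (\<forall>j<m. \<exists>x\<in>H j. \<omega> x)}"
  have "?E A m \<in> sets (percolation D p) \<and>
      P.prob (?E A m) = (1 - p) ^ card A * (1 - (1 - p) ^ k) ^ m"
    using A H disj
  proof (induction m arbitrary: A)
    case 0
    then show ?case
      using percolation_all_measurable[of A D p False] prob_all_equal[OF p, of A D False]
      by (simp add: countable_finite)
  next
    case (Suc m)
    have disj: "disjoint_family_on H {..<m}"
      using Suc.prems(4) by (rule disjoint_family_on_mono[rotated]) auto
    have H: "H j \<subseteq> sites D \<and> finite (H j) \<and> card (H j) = k" "A \<inter> H j = {}" if "j < Suc m" for j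
      using Suc.prems(3)[OF that] by auto
    have d': "H m \<inter> H j = {}" if "j < m" for j
      using Suc.prems(4) that unfolding disjoint_family_on_def by auto
    have IH1: "?E A m \<in> sets (percolation D p) \<and>
      P.prob (?E A m) = (1 - p) ^ card A * (1 - (1 - p) ^ k) ^ m"
      using Suc.prems(1,2) disj H by (intro Suc.IH) auto
    have IH2: "?E (A \<union> H m) m \<in> sets (percolation D p) \<and>
      P.prob (?E (A \<union> H m) m) = (1 - p) ^ card (A \<union> H m) * (1 - (1 - p) ^ k) ^ m"
    proof (rule Suc.IH)
      show "A \<union> H m \<subseteq> sites D" "finite (A \<union> H m)" using Suc.prems(1,2) H[of m] by auto
      show "H j \<subseteq> sites D \<and> finite (H j) \<and> card (H j) = k \<and> (A \<union> H m) \<inter> H j = {}"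
        if "j < m" for j using H[of j] d'[OF that] that by auto
    qed (rule disj)
    have card: "card (A \<union> H m) = card A + k"
      using H[of m] Suc.prems(2) by (subst card_Un_disjoint) auto
    have eq: "?E A (Suc m) = ?E A m - ?E (A \<union> H m) m"
      by (auto simp: less_Suc_eq)
    have "P.prob (?E A (Suc m)) = P.prob (?E A m) - P.prob (?E (A \<union> H m) m)"
      unfolding eq using IH1 IH2 by (intro P.finite_measure_Diff) auto
    also have "\<dots> = (1 - p) ^ card A * (1 - (1 - p) ^ k) ^ Suc m"
      using IH1 IH2 card by (simp add: power_add algebra_simps)
    finally show ?case using IH1 IH2 unfolding eq by auto
  qed
  then show "?E A m \<in> sets (percolation D p)"
    "P.prob (?E A m) = (1 - p) ^ card A * (1 - (1 - p) ^ k) ^ m" by auto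
qed

section \<open>Measurability of the embedding event\<close>

definition embeddings :: "nat \<Rightarrow> nat \<Rightarrow> nat \<Rightarrow> ((nat \<Rightarrow> int) \<Rightarrow> bool) \<Rightarrow> ((nat \<Rightarrow> int) \<Rightarrow> nat \<Rightarrow> int) set"
  where "embeddings d D M \<omega> = {f. lip d D M f \<and> inj_on f (sites d) \<and> f ` sites d \<subseteq> open_sites D \<omega>}"

text \<open>
  The sites at which an embedding that maps the origin to \<open>y\<close> can place \<open>x\<close>; there are only
  finitely many.
\<close>

definition target_ball :: "nat \<Rightarrow> nat \<Rightarrow> nat \<Rightarrow> (nat \<Rightarrow> int) \<Rightarrow> (nat \<Rightarrow> int) \<Rightarrow> (nat \<Rightarrow> int) set" where
  "target_ball d D M y x = {z \<in> sites D. l1_norm D (\<lambda>i. z i - y i) \<le> int M * l1_norm d x}"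

lemma finite_target_ball: "finite (target_ball d D M y x)"
proof -
  let ?r = "nat (int M * l1_norm d x)"
  have "target_ball d D M y x \<subseteq> cube D y ?r"
    unfolding target_ball_def using l1_norm_nonneg[of d x] by (auto intro!: in_cubeI_l1)
  then show ?thesis using finite_cube by (rule finite_subset)
qed

lemma embedding_in_target_ball:
  assumes "lip d D M f" "x \<in> sites d"
  shows "f x \<in> target_ball d D M (f (origin d)) x"
proof -
  have "l1_norm d (\<lambda>i. x i - origin d i) = l1_norm d x"
    unfolding l1_norm_def origin_def by (intro sum.cong) auto
  then show ?thesis
    using lip_bound[OF assms origin_sites] assms unfolding target_ball_def lip_def by auto
qed

text \<open>
  Tychonoff's theorem: with discrete finite fibres, the product is compact, and each pairwise
  constraint depends on two coordinates only and hence defines a closed set.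
\<close>

lemma compactness_pairwise:
  fixes B :: "'a \<Rightarrow> 'b set"
  assumes fin: "\<And>x. x \<in> X \<Longrightarrow> finite (B x)"
    and loc: "\<And>S. finite S \<Longrightarrow> S \<subseteq> X \<Longrightarrow>
       \<exists>f. \<forall>x\<in>S. f x \<in> B x \<and> (\<forall>y\<in>S. R x y (f x) (f y))"
  shows "\<exists>f. \<forall>x\<in>X. f x \<in> B x \<and> (\<forall>y\<in>X. R x y (f x) (f y))"
proof -
  define T where "T = product_topology (\<lambda>x. discrete_topology (B x)) X"
  have topT: "topspace T = (\<Pi>\<^sub>E x\<in>X. B x)" unfolding T_def by (simp add: topspace_product_topology)
  have comp: "compact_space T" unfolding T_def
    using fin by (simp add: compact_space_product_topology compact_space_discrete_topology)
  have ne: "B x \<noteq> {}" if "x \<in> X" for x using loc[of "{x}"] that by auto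
  define C where "C = (\<lambda>(x, y). {f \<in> topspace T. R x y (f x) (f y)})"
  have cl: "closedin T (C (x, y))" if "x \<in> X" "y \<in> X" for x y
  proof -
    have 1: "closedin T {f \<in> topspace T. f z = c}" if "z \<in> X" "c \<in> B z" for z c
    proof -
      have "continuous_map T (discrete_topology (B z)) (\<lambda>f. f z)"
        unfolding T_def using that(1) by (rule continuous_map_product_projection)
      from closedin_continuous_map_preimage[OF this, of "{c}"] show ?thesis using that(2) by simp
    qed
    define Q where "Q = {(a, b) \<in> B x \<times> B y. R x y a b}"
    have "finite Q" unfolding Q_def
      by (rule finite_subset[of _ "B x \<times> B y"]) (use fin that in auto)
    then have "closedin T (\<Union>((\<lambda>(a, b). {f \<in> topspace T. f x = a} \<inter> {f \<in> topspace T. f y = b}) ` Q))"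
      using 1 that by (intro closedin_Union finite_imageI) (auto simp: Q_def intro!: closedin_Int)
    also have "(\<Union>((\<lambda>(a, b). {f \<in> topspace T. f x = a} \<inter> {f \<in> topspace T. f y = b}) ` Q)) = C (x, y)"
    proof -
      have "f x \<in> B x" "f y \<in> B y" if "f \<in> topspace T" for f
        using that \<open>x \<in> X\<close> \<open>y \<in> X\<close> unfolding topT by auto
      then show ?thesis unfolding C_def Q_def by fastforce
    qed
    finally show ?thesis .
  qed
  have fip: "\<Inter>\<F> \<noteq> {}" if F: "finite \<F>" "\<F> \<subseteq> insert (topspace T) (C ` (X \<times> X))" for \<F>
  proof -
    have "finite (\<F> - {topspace T})" "\<F> - {topspace T} \<subseteq> C ` (X \<times> X)" using F by auto
    from finite_subset_image[OF this]
    obtain P where P: "P \<subseteq> X \<times> X" "finite P" "\<F> - {topspace T} = C ` P" by metis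
    define S where "S = fst ` P \<union> snd ` P"
    have S: "finite S" "S \<subseteq> X" unfolding S_def using P by auto
    obtain f where f: "\<forall>x\<in>S. f x \<in> B x \<and> (\<forall>y\<in>S. R x y (f x) (f y))" using loc[OF S] by auto
    define g where "g = (\<lambda>x\<in>X. if x \<in> S then f x else SOME b. b \<in> B x)"
    have g: "g \<in> topspace T"
      unfolding g_def topT using f ne by (auto simp: some_in_eq)
    have "g \<in> C (x, y)" if "(x, y) \<in> P" for x y
    proof -
      have "x \<in> S" "y \<in> S" unfolding S_def using that by force+
      then show ?thesis using f g S(2) unfolding C_def g_def by (simp add: subset_eq)
    qed
    then have "\<forall>Z\<in>C ` P. g \<in> Z" by auto
    then have "g \<in> Z" if "Z \<in> \<F>" for Z
    proof (cases "Z = topspace T")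
      case False
      with that have "Z \<in> C ` P" unfolding P(3)[symmetric] by blast
      with \<open>\<forall>Z\<in>C ` P. g \<in> Z\<close> show ?thesis by (rule bspec)
    qed (simp only: g)
    then show ?thesis by blast
  qed
  have "\<Inter>(insert (topspace T) (C ` (X \<times> X))) \<noteq> {}"
    using comp[unfolded compact_space_fip, rule_format, of "insert (topspace T) (C ` (X \<times> X))"]
      fip cl by auto
  then obtain f where "f \<in> topspace T" "\<forall>x\<in>X. \<forall>y\<in>X. f \<in> C (x, y)" by auto
  then show ?thesis unfolding C_def topT by (intro exI[of _ f]) auto
qed

text \<open>
  Both requirements on an embedding, injectivity and the Lipschitz condition, are constraints on
  pairs of sites. By compactness the event is a countable union (over the image of the origin) of
  countable intersections (over the finite sets of sites) of events that depend on finitely many sites.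
\<close>

lemma embedding_event_measurable:
  "{\<omega> \<in> space (percolation D p). embeddings d D M \<omega> \<noteq> {}} \<in> sets (percolation D p)"
proof -
  define R :: "(nat \<Rightarrow> int) \<Rightarrow> (nat \<Rightarrow> int) \<Rightarrow> (nat \<Rightarrow> int) \<Rightarrow> (nat \<Rightarrow> int) \<Rightarrow> bool" where
    "R = (\<lambda>x y a b. (x \<noteq> y \<longrightarrow> a \<noteq> b) \<and> (l1_norm d (\<lambda>i. x i - y i) = 1 \<longrightarrow>
        l1_norm D (\<lambda>i. a i - b i) \<le> int M))"
  \<comment> \<open>Maps of a finite set \<open>S\<close> of sites that violate none of the pairwise constraints.\<close>
  define G where "G = (\<lambda>v S. {f \<in> (\<Pi>\<^sub>E x\<in>S. target_ball d D M v x). \<forall>x\<in>S. \<forall>y\<in>S. R x y (f x) (f y)})"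
  define \<S> where "\<S> = {S. finite S \<and> S \<subseteq> sites d}"
  have fG: "finite (G v S)" if "S \<in> \<S>" for v S
    unfolding G_def using that
    by (intro finite_subset[OF _ finite_PiE[of S "\<lambda>x. target_ball d D M v x"]] finite_target_ball)
      (auto simp: \<S>_def)
  have eq: "embeddings d D M \<omega> \<noteq> {} \<longleftrightarrow> (\<exists>v\<in>sites D. \<forall>S\<in>\<S>. \<exists>f\<in>G v S. \<forall>z\<in>f ` S. \<omega> z)" for \<omega>
  proof
    assume "embeddings d D M \<omega> \<noteq> {}"
    then obtain f where f: "lip d D M f" "inj_on f (sites d)" "f ` sites d \<subseteq> open_sites D \<omega>"
      unfolding embeddings_def by auto
    show "\<exists>v\<in>sites D. \<forall>S\<in>\<S>. \<exists>f\<in>G v S. \<forall>z\<in>f ` S. \<omega> z"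
    proof (intro bexI ballI)
      fix S z assume S: "S \<in> \<S>"
      have "S \<subseteq> sites d" using S unfolding \<S>_def by auto
      moreover have "R x y (f x) (f y)" if "x \<in> sites d" "y \<in> sites d" for x y
        using f(1,2) that unfolding R_def lip_def inj_on_def by blast
      ultimately show "restrict f S \<in> G (f (origin d)) S"
        using embedding_in_target_ball[OF f(1)] unfolding G_def by (simp add: subset_eq)
      assume "z \<in> restrict f S ` S"
      then show "\<omega> z" using f(3) S unfolding \<S>_def open_sites_def by auto
    next
      show "f (origin d) \<in> sites D" using f(1) origin_sites unfolding lip_def by auto
    qed
  next
    assume "\<exists>v\<in>sites D. \<forall>S\<in>\<S>. \<exists>f\<in>G v S. \<forall>z\<in>f ` S. \<omega> z"
    then obtain v where v: "\<forall>S\<in>\<S>. \<exists>f\<in>G v S. \<forall>z\<in>f ` S. \<omega> z" by auto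
    have "\<exists>f. \<forall>x\<in>sites d. f x \<in> {z \<in> target_ball d D M v x. \<omega> z} \<and> (\<forall>y\<in>sites d. R x y (f x) (f y))"
    proof (rule compactness_pairwise)
      show "finite {z \<in> target_ball d D M v x. \<omega> z}" for x using finite_target_ball by auto
      show "\<exists>f. \<forall>x\<in>S. f x \<in> {z \<in> target_ball d D M v x. \<omega> z} \<and> (\<forall>y\<in>S. R x y (f x) (f y))"
        if S: "finite S" "S \<subseteq> sites d" for S
      proof -
        have "S \<in> \<S>" using S unfolding \<S>_def by auto
        then obtain f where f: "f \<in> G v S" "\<forall>z\<in>f ` S. \<omega> z" using v by blast
        show ?thesis using f unfolding G_def by (intro exI[of _ f]) auto
      qed
    qed
    then obtain f where f: "\<And>x. x \<in> sites d \<Longrightarrow> f x \<in> target_ball d D M v x \<and> \<omega> (f x)"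
      "\<And>x y. x \<in> sites d \<Longrightarrow> y \<in> sites d \<Longrightarrow> R x y (f x) (f y)" by blast
    have "f x \<in> sites D" if "x \<in> sites d" for x
      using f(1)[OF that] unfolding target_ball_def by auto
    moreover have "lip d D M f"
      using f(2) calculation unfolding lip_def R_def by blast
    moreover have "inj_on f (sites d)"
      using f(2) unfolding inj_on_def R_def by blast
    ultimately have "f \<in> embeddings d D M \<omega>"
      using f(1) unfolding embeddings_def open_sites_def by blast
    then show "embeddings d D M \<omega> \<noteq> {}" by auto
  qed
  have "{\<omega> \<in> space (percolation D p). embeddings d D M \<omega> \<noteq> {}}
     = (\<Union>v\<in>sites D. \<Inter>S\<in>\<S>. \<Union>f\<in>G v S. {\<omega> \<in> space (percolation D p). \<forall>z\<in>f ` S. \<omega> z = True})"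
  proof -
    have "{} \<in> \<S>" unfolding \<S>_def by auto
    then show ?thesis unfolding eq by (simp add: set_eq_iff) blast
  qed
  also have "\<dots> \<in> sets (percolation D p)"
  proof -
    let ?U = "\<lambda>v S. \<Union>f\<in>G v S. {\<omega> \<in> space (percolation D p). \<forall>z\<in>f ` S. \<omega> z = True}"
    have "{\<omega> \<in> space (percolation D p). \<forall>z\<in>f ` S. \<omega> z = True} \<in> sets (percolation D p)"
      if "S \<in> \<S>" "f \<in> G v S" for v S f
    proof (rule percolation_all_measurable)
      show "f ` S \<subseteq> sites D" using that unfolding G_def target_ball_def by blast
      show "countable (f ` S)" using that unfolding \<S>_def by (simp add: countable_finite)
    qed
    then have "?U v S \<in> sets (percolation D p)" if "S \<in> \<S>" for v S
      using that fG by (intro sets.finite_UN) auto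
    moreover have "countable \<S>" unfolding \<S>_def using countable_sites by (rule countable_Collect_finite_subset)
    moreover have "\<S> \<noteq> {}" unfolding \<S>_def by auto
    ultimately have "(\<Inter>S\<in>\<S>. ?U v S) \<in> sets (percolation D p)" for v
      by (intro sets.countable_INT') auto
    then show ?thesis by (intro sets.countable_UN' countable_sites) auto
  qed
  finally show ?thesis .
qed

lemma lip_prob_eq:
  "lip_prob d D M p = measure (percolation D p) {\<omega> \<in> space (percolation D p). embeddings d D M \<omega> \<noteq> {}}"
  unfolding lip_prob_def embeddings_def by (intro arg_cong[where f = "measure _"]) auto

text \<open>
  The first-moment scheme of both negative results: it suffices to treat each image \<open>v\<close> of the origin
  separately, since there are countably many, and for each \<open>v\<close> to find necessary events of
  arbitrarily small probability.
\<close>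

lemma lip_prob_eq_0I:
  assumes meas: "\<And>v n. v \<in> sites D \<Longrightarrow> U v n \<in> sets (percolation D p)"
    and obst: "\<And>f \<omega> n. \<omega> \<in> space (percolation D p) \<Longrightarrow> f \<in> embeddings d D M \<omega> \<Longrightarrow>
       \<omega> \<in> U (f (origin d)) n"
    and bound: "\<And>v n. v \<in> sites D \<Longrightarrow> measure (percolation D p) (U v n) \<le> a n"
    and lim: "a \<longlonglongrightarrow> 0"
  shows "lip_prob d D M p = 0"
proof -
  interpret P: prob_space "percolation D p" by (rule prob_space_percolation)
  have null: "(\<Inter>n. U v n) \<in> null_sets (percolation D p)" if v: "v \<in> sites D" for v
  proof -
    have m: "(\<Inter>n. U v n) \<in> sets (percolation D p)" using meas[OF v] by auto
    have "P.prob (\<Inter>n. U v n) \<le> a n" for n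
      using bound[OF v, of n] P.finite_measure_mono[of "\<Inter>n. U v n" "U v n"] meas[OF v] by force
    then have "P.prob (\<Inter>n. U v n) \<le> 0"
      by (intro tendsto_lowerbound[OF lim]) auto
    then have "P.prob (\<Inter>n. U v n) = 0" using measure_nonneg[of "percolation D p" "\<Inter>n. U v n"] by linarith
    then show ?thesis using m by (simp add: null_sets_def P.emeasure_eq_measure)
  qed
  have "(\<Union>v\<in>sites D. \<Inter>n. U v n) \<in> null_sets (percolation D p)"
    using null by (intro null_sets_UN' countable_sites) auto
  moreover have "{\<omega> \<in> space (percolation D p). embeddings d D M \<omega> \<noteq> {}} \<subseteq> (\<Union>v\<in>sites D. \<Inter>n. U v n)"
  proof
    fix \<omega> assume "\<omega> \<in> {\<omega> \<in> space (percolation D p). embeddings d D M \<omega> \<noteq> {}}"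
    then obtain f where f: "\<omega> \<in> space (percolation D p)" "f \<in> embeddings d D M \<omega>" by auto
    then have "f (origin d) \<in> sites D"
      using origin_sites unfolding embeddings_def lip_def by auto
    then show "\<omega> \<in> (\<Union>v\<in>sites D. \<Inter>n. U v n)" using obst[OF f] by auto
  qed
  ultimately have "{\<omega> \<in> space (percolation D p). embeddings d D M \<omega> \<noteq> {}} \<in> null_sets (percolation D p)"
    using embedding_event_measurable null_sets_subset by blast
  then show ?thesis unfolding lip_prob_eq by (simp add: null_sets_def P.emeasure_eq_measure)
qed

lemma poly_times_geometric_tendsto_0:
  fixes \<theta> :: real
  assumes "0 \<le> \<theta>" "\<theta> < 1"
  shows "(\<lambda>n. real n ^ k * \<theta> ^ n) \<longlonglongrightarrow> 0"
proof (cases "k = 0")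
  case True
  then show ?thesis using assms by (simp add: LIMSEQ_power_zero)
next
  case False
  define \<tau> where "\<tau> = root k \<theta>"
  have \<tau>: "0 \<le> \<tau>" "\<tau> < 1" "\<tau> ^ k = \<theta>"
    using False assms unfolding \<tau>_def by auto
  have "(\<lambda>n. (real n * \<tau> ^ n) ^ k) \<longlonglongrightarrow> 0 ^ k"
    using \<tau> by (intro tendsto_power powser_times_n_limit_0) auto
  moreover have "(real n * \<tau> ^ n) ^ k = real n ^ k * \<theta> ^ n" for n
    unfolding \<tau>(3)[symmetric] by (simp add: power_mult_distrib power_mult[symmetric] mult.commute)
  ultimately show ?thesis using False by (simp add: power_0_left)
qed

section \<open>A Lipschitz surface of open sites\<close>

text \<open>
  Sites of the target are read as a column, given by the coordinates below \<open>d\<close>, and a height, the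
  coordinate \<open>d\<close>; \<open>l1_norm d\<close> therefore measures the sideways displacement. The sideways freedom in
  a downward step is what will make the surface Lipschitz.
\<close>

definition climb :: "nat \<Rightarrow> ((nat \<Rightarrow> int) \<Rightarrow> bool) \<Rightarrow> (nat \<Rightarrow> int) \<Rightarrow> (nat \<Rightarrow> int) \<Rightarrow> bool" where
  "climb d \<omega> y z \<longleftrightarrow> y \<in> sites (Suc d) \<and> z \<in> sites (Suc d) \<and>
     (z d = y d + 1 \<and> (\<forall>i<d. z i = y i) \<and> \<not> \<omega> z \<or>
      z d = y d - 1 \<and> l1_norm d (\<lambda>i. z i - y i) \<le> 1)"

text \<open>
  Paths are listed from their end back to their start, which lies at height at most 0.
\<close>

fun climb_path :: "nat \<Rightarrow> ((nat \<Rightarrow> int) \<Rightarrow> bool) \<Rightarrow> (nat \<Rightarrow> int) list \<Rightarrow> bool" where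
  "climb_path d \<omega> [] \<longleftrightarrow> False"
| "climb_path d \<omega> [y] \<longleftrightarrow> y \<in> sites (Suc d) \<and> y d \<le> 0"
| "climb_path d \<omega> (z # y # ys) \<longleftrightarrow> climb d \<omega> y z \<and> climb_path d \<omega> (y # ys)"

text \<open>
  The path is required to be self-avoiding, so that the closed sites that it lands on are distinct and
  independent of each other.
\<close>

definition reached :: "nat \<Rightarrow> ((nat \<Rightarrow> int) \<Rightarrow> bool) \<Rightarrow> (nat \<Rightarrow> int) set" where
  "reached d \<omega> = {z. \<exists>zs. climb_path d \<omega> zs \<and> distinct zs \<and> hd zs = z}"

lemma climb_path_suffix: "climb_path d \<omega> (xs @ ys) \<Longrightarrow> ys \<noteq> [] \<Longrightarrow> climb_path d \<omega> ys"
proof (induction xs)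
  case (Cons x xs)
  then show ?case by (cases "xs @ ys") auto
qed simp

lemma reached_ground: "z \<in> sites (Suc d) \<Longrightarrow> z d \<le> 0 \<Longrightarrow> z \<in> reached d \<omega>"
  unfolding reached_def by (intro CollectI exI[of _ "[z]"]) simp

text \<open>
  If the new site already lies on the path, the path is cut off there.
\<close>

lemma reached_climb:
  assumes y: "y \<in> reached d \<omega>" and yz: "climb d \<omega> y z"
  shows "z \<in> reached d \<omega>"
proof -
  obtain zs where zs: "climb_path d \<omega> zs" "distinct zs" "hd zs = y"
    using y unfolding reached_def by auto
  show ?thesis
  proof (cases "z \<in> set zs")
    case True
    then obtain us vs where "zs = us @ z # vs" by (metis split_list)
    then have "climb_path d \<omega> (z # vs)" "distinct (z # vs)" using zs climb_path_suffix by auto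
    then show ?thesis unfolding reached_def by (metis (mono_tags, lifting) list.sel(1) mem_Collect_eq)
  next
    case False
    obtain ys where "zs = y # ys" using zs by (cases zs) auto
    then have "climb_path d \<omega> (z # zs)" "distinct (z # zs)" using zs yz False by auto
    then show ?thesis unfolding reached_def by (metis (mono_tags, lifting) list.sel(1) mem_Collect_eq)
  qed
qed

fun landings :: "nat \<Rightarrow> (nat \<Rightarrow> int) list \<Rightarrow> (nat \<Rightarrow> int) set" where
  "landings d (z # y # ys) = (if z d = y d + 1 then {z} else {}) \<union> landings d (y # ys)"
| "landings d _ = {}"

lemma landings_subset: "landings d zs \<subseteq> set zs"
  by (induction d zs rule: landings.induct) auto

text \<open>
  A path that ends at height \<open>h\<close> has at least \<open>h\<close> more upward than downward steps, so at
  least \<open>(n + h) / 2\<close> of its \<open>n\<close> steps are landings on closed sites.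
\<close>

lemma climb_path_landings:
  assumes "climb_path d \<omega> zs" "distinct zs"
  shows "(\<forall>x\<in>landings d zs. \<not> \<omega> x) \<and> hd zs d + int (length zs - 1) \<le> 2 * int (card (landings d zs))"
  using assms
proof (induction d zs rule: landings.induct)
  case (1 d z y ys)
  have fin: "finite (landings d (y # ys))" and z: "z \<notin> landings d (y # ys)"
    using landings_subset[of d "y # ys"] 1(3) by (auto intro: finite_subset)
  have IH: "\<forall>x\<in>landings d (y # ys). \<not> \<omega> x"
    "y d + int (length ys) \<le> 2 * int (card (landings d (y # ys)))" using 1 by auto
  have "climb d \<omega> y z" using 1(2) by simp
  then consider "z d = y d + 1" "\<not> \<omega> z" | "z d = y d - 1" unfolding climb_def by auto
  then show ?case
  proof cases
    case 1
    then have "card (landings d (z # y # ys)) = Suc (card (landings d (y # ys)))"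
      using fin z by simp
    then show ?thesis using 1 IH by simp
  next
    case 2
    then have "landings d (z # y # ys) = landings d (y # ys)" by simp
    then show ?thesis using 2 IH by simp
  qed
qed auto

text \<open>
  The supply of paths for the union bound, independent of the configuration: any list of sites in
  which successive sites differ by at most 1 in each coordinate. Allowing all of these costs only a
  larger constant.
\<close>

fun descents :: "nat \<Rightarrow> nat \<Rightarrow> (nat \<Rightarrow> int) \<Rightarrow> (nat \<Rightarrow> int) list set" where
  "descents d 0 z = {[z]}"
| "descents d (Suc n) z = (\<Union>y\<in>cube (Suc d) z 1. (#) z ` descents d n y)"

lemma climb_imp_cube:
  assumes "climb d \<omega> y z"
  shows "y \<in> cube (Suc d) z 1"
proof (rule in_cubeI_sup)
  show "y \<in> sites (Suc d)" using assms unfolding climb_def by simp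
  show "\<bar>y i - z i\<bar> \<le> int 1" if i: "i < Suc d" for i
  proof (cases "i = d")
    case True
    then show ?thesis using assms unfolding climb_def by auto
  next
    case False
    then have "i < d" using i by simp
    then show ?thesis
      using assms l1_norm_component_le[of i d "\<lambda>i. z i - y i"] unfolding climb_def by fastforce
  qed
qed

lemma climb_path_in_descents:
  "climb_path d \<omega> zs \<Longrightarrow> zs \<in> descents d (length zs - 1) (hd zs)"
proof (induction d \<omega> zs rule: climb_path.induct)
  case (3 d \<omega> z y ys)
  have "y \<in> cube (Suc d) z 1" using 3(2) climb_imp_cube by auto
  then show ?case using 3 by auto
qed auto

lemma finite_descents: "finite (descents d n z)"
  by (induction n arbitrary: z) (auto intro: finite_cube)

lemma card_descents_le: "card (descents d n z) \<le> (3 ^ Suc d) ^ n"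
proof (induction n arbitrary: z)
  case (Suc n)
  have "card (descents d (Suc n) z) \<le> (\<Sum>y\<in>cube (Suc d) z 1. card ((#) z ` descents d n y))"
    using card_UN_le[OF finite_cube] by simp
  also have "\<dots> \<le> (\<Sum>y\<in>cube (Suc d) z 1. (3 ^ Suc d) ^ n)"
    by (intro sum_mono order_trans[OF card_image_le[OF finite_descents] Suc])
  also have "\<dots> = (3 ^ Suc d) ^ Suc n" by (simp add: card_cube)
  finally show ?case .
qed simp

lemma cube_subset_sites: "cube D v r \<subseteq> sites D"
  unfolding cube_def sites_def by (auto simp: PiE_iff)

lemma descents_sites: "z \<in> sites (Suc d) \<Longrightarrow> zs \<in> descents d n z \<Longrightarrow> set zs \<subseteq> sites (Suc d)"
proof (induction n arbitrary: z zs)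
  case (Suc n)
  then obtain y ys where y: "y \<in> cube (Suc d) z 1" "ys \<in> descents d n y" "zs = z # ys" by auto
  then have "set ys \<subseteq> sites (Suc d)" using Suc.IH cube_subset_sites by blast
  then show ?case using y Suc.prems by simp
qed simp

text \<open>
  The density \<open>t\<^sup>2\<close> of closed sites is chosen such that the number \<open>b ^ n\<close> of paths, where
  \<open>b = 1 / (2 t)\<close>, multiplied by the probability \<open>t ^ (n + h)\<close> of \<open>(n + h) / 2\<close> closed sites is
  \<open>t ^ h / 2 ^ n\<close>.
\<close>

lemma prob_reached_bound:
  fixes p t :: real
  assumes p: "p = 1 - t\<^sup>2" and t: "t = 1 / (2 * 3 ^ Suc d)"
    and z: "z \<in> sites (Suc d)" "z d = int h"
  shows "\<exists>U\<in>sets (percolation (Suc d) p). measure (percolation (Suc d) p) U \<le> 2 * t ^ h \<and>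
    {\<omega> \<in> space (percolation (Suc d) p). z \<in> reached d \<omega>} \<subseteq> U"
proof -
  interpret P: prob_space "percolation (Suc d) p" by (rule prob_space_percolation)
  define b where "b = (3 :: real) ^ Suc d"
  have b: "1 \<le> b" unfolding b_def by (rule one_le_power) simp
  have t': "t = 1 / (2 * b)" unfolding t b_def by simp
  have t01: "0 \<le> t" "t \<le> 1" unfolding t' using b by auto
  have p01: "p \<in> {0..1}" unfolding p using t01 by (simp add: power_le_one)
  define \<A> where "\<A> = (\<lambda>n. {A \<in> landings d ` descents d n z. n + h \<le> 2 * card A})"
  define U where "U = (\<lambda>n. {\<omega> \<in> space (percolation (Suc d) p). \<exists>A\<in>\<A> n. \<forall>x\<in>A. \<omega> x = False})"
  have fin: "finite (\<A> n)" for n unfolding \<A>_def using finite_descents by auto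
  have card: "real (card (\<A> n)) \<le> b ^ n" for n
  proof -
    have "card (\<A> n) \<le> card (landings d ` descents d n z)"
      unfolding \<A>_def using finite_descents by (intro card_mono) auto
    also have "\<dots> \<le> card (descents d n z)" by (rule card_image_le[OF finite_descents])
    also have "\<dots> \<le> (3 ^ Suc d) ^ n" by (rule card_descents_le)
    finally have "real (card (\<A> n)) \<le> real ((3 ^ Suc d) ^ n)" by (rule of_nat_mono)
    then show ?thesis unfolding b_def by (simp only: of_nat_power of_nat_numeral)
  qed
  have A: "A \<subseteq> sites (Suc d) \<and> finite A \<and> (n + h + 1) div 2 \<le> card A" if "A \<in> \<A> n" for A n
  proof -
    obtain zs where zs: "zs \<in> descents d n z" "A = landings d zs" and c: "n + h \<le> 2 * card A"
      using \<open>A \<in> \<A> n\<close> unfolding \<A>_def by auto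
    have "A \<subseteq> set zs" unfolding zs by (rule landings_subset)
    then show ?thesis using descents_sites[OF z(1) zs(1)] c by (auto intro: finite_subset)
  qed
  have meas: "U n \<in> sets (percolation (Suc d) p)" for n
    unfolding U_def using fin p01 A by (rule union_bound(1))
  have bound: "P.prob (U n) \<le> t ^ h * (1 / 2) ^ n" for n
  proof -
    have "P.prob (U n) \<le> card (\<A> n) * (if False then p else 1 - p) ^ ((n + h + 1) div 2)"
      unfolding U_def using fin p01 A by (rule union_bound(2))
    also have "\<dots> = card (\<A> n) * t ^ (2 * ((n + h + 1) div 2))"
      unfolding p by (simp add: power_mult)
    also have "\<dots> \<le> b ^ n * t ^ (n + h)"
      using card t01 b by (intro mult_mono power_decreasing) auto
    also have "\<dots> = t ^ h * (b * t) ^ n" by (simp add: power_add power_mult_distrib)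
    also have "b * t = 1 / 2" unfolding t' using b by simp
    finally show ?thesis .
  qed
  have geo: "summable (\<lambda>n. t ^ h * (1 / 2) ^ n)" "(\<Sum>n. t ^ h * (1 / 2) ^ n) = 2 * t ^ h"
    by (auto simp: suminf_mult summable_geometric suminf_geometric intro!: summable_mult)
  have sm: "summable (\<lambda>n. P.prob (U n))"
    using geo(1) by (rule summable_comparison_test[rotated]) (use bound in auto)
  have "P.prob (\<Union>n. U n) \<le> (\<Sum>n. P.prob (U n))"
    using meas sm by (intro P.finite_measure_subadditive_countably) auto
  also have "\<dots> \<le> (\<Sum>n. t ^ h * (1 / 2) ^ n)" using bound sm geo(1) by (intro suminf_le) auto
  finally have prob: "P.prob (\<Union>n. U n) \<le> 2 * t ^ h" unfolding geo(2) .
  have sub: "{\<omega> \<in> space (percolation (Suc d) p). z \<in> reached d \<omega>} \<subseteq> (\<Union>n. U n)"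
  proof
    fix \<omega> assume \<omega>: "\<omega> \<in> {\<omega> \<in> space (percolation (Suc d) p). z \<in> reached d \<omega>}"
    then obtain zs where zs: "climb_path d \<omega> zs" "distinct zs" "hd zs = z"
      unfolding reached_def by auto
    note l = climb_path_landings[OF zs(1,2)]
    have "landings d zs \<in> \<A> (length zs - 1)"
      unfolding \<A>_def using climb_path_in_descents[OF zs(1)] l zs(3) z(2) by auto
    then show "\<omega> \<in> (\<Union>n. U n)" using l \<omega> unfolding U_def by blast
  qed
  show ?thesis using prob sub meas by (intro bexI[of _ "\<Union>n. U n"]) auto
qed

lemma lift_site: "x \<in> sites d \<Longrightarrow> x(d := t) \<in> sites (Suc d)"
  unfolding sites_def by (auto simp: PiE_iff extensional_def)

text \<open>
  The embedding is the graph of the height \<open>F x\<close> of the lowest unreached site above \<open>x\<close>. If \<open>F\<close>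
  increased by more than 1 from \<open>y\<close> to a neighbour \<open>x\<close>, the site at height \<open>F y + 1\<close> above \<open>x\<close> would
  be reached, and one downward step from it would reach the unreached site above \<open>y\<close>.
\<close>

lemma embedding_of_bounded_reach:
  assumes fin: "\<And>x. x \<in> sites d \<Longrightarrow> \<exists>h. x(d := int h) \<notin> reached d \<omega>"
  shows "embeddings d (Suc d) 2 \<omega> \<noteq> {}"
proof -
  define F where "F = (\<lambda>x. LEAST h. x(d := int h) \<notin> reached d \<omega>)"
  define f where "f = (\<lambda>x. x(d := int (F x)))"
  have F: "f x \<notin> reached d \<omega>" if "x \<in> sites d" for x
    unfolding f_def F_def using fin[OF that] by (rule LeastI_ex)
  have F_le: "F x \<le> h" if "x(d := int h) \<notin> reached d \<omega>" for x h
    unfolding F_def using that by (rule Least_le)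
  have fs: "f x \<in> sites (Suc d)" if "x \<in> sites d" for x unfolding f_def by (rule lift_site[OF that])
  have op: "\<omega> (f x)" if x: "x \<in> sites d" for x
  proof (rule ccontr)
    assume closed: "\<not> \<omega> (f x)"
    have "F x \<noteq> 0"
    proof
      assume "F x = 0"
      then have "f x d \<le> 0" unfolding f_def by simp
      then show False using reached_ground[OF fs[OF x]] F[OF x] by blast
    qed
    then obtain h where h: "F x = Suc h" by (cases "F x") auto
    have "x(d := int h) \<in> reached d \<omega>" using F_le[of x h] h by auto
    moreover have "climb d \<omega> (x(d := int h)) (f x)"
      unfolding climb_def using lift_site[OF x] fs[OF x] closed h by (auto simp: f_def)
    ultimately show False using reached_climb F[OF x] by blast
  qed
  have step: "F x \<le> F y + 1"
    if x: "x \<in> sites d" and y: "y \<in> sites d" and xy: "l1_norm d (\<lambda>i. x i - y i) = 1" for x y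
  proof (rule F_le, rule notI)
    assume r: "x(d := int (F y + 1)) \<in> reached d \<omega>"
    have "l1_norm d (\<lambda>i. (f y) i - (x(d := int (F y + 1))) i) = l1_norm d (\<lambda>i. x i - y i)"
      unfolding l1_norm_def f_def by (intro sum.cong) (auto simp: abs_minus_commute)
    then have "climb d \<omega> (x(d := int (F y + 1))) (f y)"
      unfolding climb_def using lift_site[OF x] fs[OF y] xy by (auto simp: f_def)
    then show False using reached_climb[OF r] F[OF y] by blast
  qed
  have "lip d (Suc d) 2 f"
    unfolding lip_def
  proof (intro conjI ballI impI)
    show "f \<in> sites d \<rightarrow> sites (Suc d)" using fs by auto
    fix x y assume x: "x \<in> sites d" and y: "y \<in> sites d" and xy: "l1_norm d (\<lambda>i. x i - y i) = 1"
    have yx: "l1_norm d (\<lambda>i. y i - x i) = 1"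
      using xy unfolding l1_norm_def by (simp add: abs_minus_commute)
    have "l1_norm (Suc d) (\<lambda>i. f x i - f y i) = l1_norm d (\<lambda>i. x i - y i) + \<bar>int (F x) - int (F y)\<bar>"
      unfolding l1_norm_def f_def by simp
    also have "\<dots> \<le> 2" using step[OF x y xy] step[OF y x yx] xy by linarith
    finally show "l1_norm (Suc d) (\<lambda>i. f x i - f y i) \<le> int 2" by simp
  qed
  moreover have "inj_on f (sites d)"
  proof (rule inj_onI)
    fix x y assume xy: "x \<in> sites d" "y \<in> sites d" "f x = f y"
    have "x i = y i" if "i < d" for i
      using fun_cong[OF xy(3), of i] that unfolding f_def by simp
    then show "x = y" using xy(1,2) by (intro sites_eqI)
  qed
  ultimately have "f \<in> embeddings d (Suc d) 2 \<omega>"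
    using fs op unfolding embeddings_def open_sites_def by auto
  then show ?thesis by auto
qed

lemma lip_prob_eq_1_codim_1: "\<exists>p. 0 \<le> p \<and> p < 1 \<and> lip_prob d (Suc d) 2 p = 1"
proof -
  define t :: real where "t = 1 / (2 * 3 ^ Suc d)"
  define p where "p = 1 - t\<^sup>2"
  have "(1 :: real) \<le> 3 ^ Suc d" by (rule one_le_power) simp
  then have "1 < 2 * (3 :: real) ^ Suc d" by linarith
  then have t: "0 < t" "t < 1" unfolding t_def by (auto simp del: power_Suc)
  interpret P: prob_space "percolation (Suc d) p" by (rule prob_space_percolation)
  have "AE \<omega> in percolation (Suc d) p. \<exists>h. x(d := int h) \<notin> reached d \<omega>" if x: "x \<in> sites d" for x
  proof -
    have "\<forall>h. \<exists>U. U \<in> sets (percolation (Suc d) p) \<and> P.prob U \<le> 2 * t ^ h \<and>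
        {\<omega> \<in> space (percolation (Suc d) p). x(d := int h) \<in> reached d \<omega>} \<subseteq> U"
    proof
      fix h
      show "\<exists>U. U \<in> sets (percolation (Suc d) p) \<and> P.prob U \<le> 2 * t ^ h \<and>
        {\<omega> \<in> space (percolation (Suc d) p). x(d := int h) \<in> reached d \<omega>} \<subseteq> U"
        using prob_reached_bound[OF p_def t_def lift_site[OF x, of "int h"], of h] by auto
    qed
    from choice[OF this] obtain U where U: "\<And>h. U h \<in> sets (percolation (Suc d) p)"
      "\<And>h. P.prob (U h) \<le> 2 * t ^ h"
      "\<And>h. {\<omega> \<in> space (percolation (Suc d) p). x(d := int h) \<in> reached d \<omega>} \<subseteq> U h" by blast
    have m: "(\<Inter>h. U h) \<in> sets (percolation (Suc d) p)" using U(1) by auto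
    have "P.prob (\<Inter>h. U h) \<le> 2 * t ^ h" for h
      using U(2)[of h] P.finite_measure_mono[of "\<Inter>h. U h" "U h"] U(1) by force
    then have le: "\<forall>\<^sub>F h in sequentially. P.prob (\<Inter>h. U h) \<le> 2 * t ^ h"
      by (intro always_eventually allI)
    have "(\<lambda>h. 2 * t ^ h) \<longlonglongrightarrow> 2 * 0"
      using t by (intro tendsto_mult tendsto_const LIMSEQ_power_zero) auto
    then have "P.prob (\<Inter>h. U h) \<le> 2 * 0"
      using le by (rule tendsto_lowerbound) simp
    then have "P.prob (\<Inter>h. U h) = 0"
      using measure_nonneg[of "percolation (Suc d) p" "\<Inter>h. U h"] by linarith
    then have "(\<Inter>h. U h) \<in> null_sets (percolation (Suc d) p)"
      using m by (simp add: null_sets_def P.emeasure_eq_measure)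
    then show ?thesis
      by (rule AE_I') (use U(3) in blast)
  qed
  then have "AE \<omega> in percolation (Suc d) p. \<forall>x\<in>sites d. \<exists>h. x(d := int h) \<notin> reached d \<omega>"
    using countable_sites by (simp add: AE_ball_countable)
  then have "AE \<omega> in percolation (Suc d) p. embeddings d (Suc d) 2 \<omega> \<noteq> {}"
    by (rule AE_mp) (auto intro!: AE_I2 embedding_of_bounded_reach)
  then have "lip_prob d (Suc d) 2 p = 1"
    unfolding lip_prob_eq using P.prob_Collect_eq_1[OF embedding_event_measurable] by simp
  moreover have "0 \<le> p" "p < 1" unfolding p_def using t by (auto simp: power_le_one)
  ultimately show ?thesis by blast
qed


section \<open>Lipschitz constant 1 in two dimensions\<close>

lemma unit_vectorE:
  assumes "l1_norm D u = 1"
  obtains i s where "i < D" "\<bar>s\<bar> = 1" "\<And>j. j < D \<Longrightarrow> u j = (if j = i then s else 0)"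
proof -
  have "\<exists>i<D. u i \<noteq> 0"
    using assms unfolding l1_norm_def by (metis abs_zero lessThan_iff sum.neutral zero_neq_one)
  then obtain i where i: "i < D" "u i \<noteq> 0" by auto
  have sum: "\<bar>u i\<bar> + (\<Sum>j\<in>{..<D} - {i}. \<bar>u j\<bar>) = 1"
    using assms i(1) unfolding l1_norm_def by (subst (asm) sum.remove[of _ i]) auto
  moreover have "(\<Sum>j\<in>{..<D} - {i}. \<bar>u j\<bar>) \<ge> 0" by (intro sum_nonneg) auto
  ultimately have "\<bar>u i\<bar> = 1" "(\<Sum>j\<in>{..<D} - {i}. \<bar>u j\<bar>) = 0" using i(2) by linarith+
  moreover have "u j = 0" if "j < D" "j \<noteq> i" for j
    using calculation(2) that by (subst (asm) sum_nonneg_eq_0_iff) auto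
  ultimately show thesis using i(1) by (intro that[of i "u i"]) auto
qed

text \<open>
  Here \<open>a, b, c, e\<close> are the corners of a square in cyclic order. Both \<open>b - a, c - b\<close> and \<open>e - a, c - e\<close>
  are decompositions of \<open>c - a\<close> into two unit vectors. As \<open>c - a\<close> is nonzero the decomposition is
  unique up to order, and the two orders are different because \<open>b\<close> and \<open>e\<close> are.
\<close>

lemma parallelogram_of_unit_square:
  assumes sites: "a \<in> sites D" "b \<in> sites D" "c \<in> sites D" "e \<in> sites D"
    and ne: "a \<noteq> c" "b \<noteq> e"
    and unit: "l1_norm D (\<lambda>m. b m - a m) = 1" "l1_norm D (\<lambda>m. c m - b m) = 1"
      "l1_norm D (\<lambda>m. e m - a m) = 1" "l1_norm D (\<lambda>m. c m - e m) = 1"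
    and m: "m < D"
  shows "b m - a m = c m - e m"
proof -
  obtain i s where i: "i < D" "\<bar>s\<bar> = 1" "\<And>m. m < D \<Longrightarrow> b m - a m = (if m = i then s else 0)"
    using unit_vectorE[OF unit(1)] by metis
  obtain j t where j: "j < D" "\<bar>t\<bar> = 1" "\<And>m. m < D \<Longrightarrow> c m - b m = (if m = j then t else 0)"
    using unit_vectorE[OF unit(2)] by metis
  obtain k s' where k: "k < D" "\<bar>s'\<bar> = 1" "\<And>m. m < D \<Longrightarrow> e m - a m = (if m = k then s' else 0)"
    using unit_vectorE[OF unit(3)] by metis
  obtain l t' where l: "l < D" "\<bar>t'\<bar> = 1" "\<And>m. m < D \<Longrightarrow> c m - e m = (if m = l then t' else 0)"
    using unit_vectorE[OF unit(4)] by metis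
  have eq: "(if m = i then s else 0) + (if m = j then t else 0)
      = (if m = k then s' else 0) + (if m = l then t' else 0)" if "m < D" for m
    using i(3)[OF that] j(3)[OF that] k(3)[OF that] l(3)[OF that] by linarith
  have 1: "\<not> (i = k \<and> s = s')"
  proof
    assume *: "i = k \<and> s = s'"
    have "b = e"
      using sites(2,4)
    proof (rule sites_eqI)
      fix m assume "m < D"
      then show "b m = e m" using i(3)[of m] k(3)[of m] * by (auto split: if_splits)
    qed
    then show False using ne by simp
  qed
  have 2: "\<not> (i = j \<and> s + t = 0)"
  proof
    assume *: "i = j \<and> s + t = 0"
    have "a = c"
      using sites(1,3)
    proof (rule sites_eqI)
      fix m assume "m < D"
      then show "a m = c m" using i(3)[of m] j(3)[of m] * by (auto split: if_splits)
    qed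
    then show False using ne by simp
  qed
  have "i = l \<and> s = t'"
    using eq[OF i(1)] 1 2 i(2) j(2) k(2) l(2) by (auto simp: abs_if split: if_splits)
  then show ?thesis using i(3)[OF m] l(3)[OF m] by simp
qed

definition plane_site :: "int \<Rightarrow> int \<Rightarrow> nat \<Rightarrow> int" where
  "plane_site i j = (\<lambda>k\<in>{..<2}. if k = 0 then i else j)"

lemma plane_site_sites: "plane_site i j \<in> sites 2"
  unfolding plane_site_def sites_def by auto

lemma plane_site_eq_iff: "plane_site i j = plane_site i' j' \<longleftrightarrow> i = i' \<and> j = j'"
proof
  assume "plane_site i j = plane_site i' j'"
  then have "plane_site i j 0 = plane_site i' j' 0" "plane_site i j 1 = plane_site i' j' 1" by auto
  then show "i = i' \<and> j = j'" unfolding plane_site_def by auto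
qed simp

lemma l1_norm_plane_site:
  "l1_norm 2 (\<lambda>k. plane_site i j k - plane_site i' j' k) = \<bar>i - i'\<bar> + \<bar>j - j'\<bar>"
  unfolding l1_norm_def plane_site_def by (simp add: numeral_2_eq_2)

text \<open>
  Injectivity turns the bound 1 for the length of the image of an edge into equality, so the preceding
  lemma applies to every unit square.
\<close>

lemma one_lip_injection_splits:
  assumes f: "lip 2 D 1 f" "inj_on f (sites 2)" and m: "m < D"
  shows "f (plane_site (int i) (int j)) m
     = f (plane_site (int i) 0) m + f (plane_site 0 (int j)) m - f (plane_site 0 0) m"
proof -
  let ?F = "\<lambda>i j. f (plane_site i j)"
  have F: "?F i j \<in> sites D" for i j using f(1) plane_site_sites unfolding lip_def by auto
  have inj: "?F i j \<noteq> ?F i' j'" if "(i, j) \<noteq> (i', j')" for i j i' j'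
    using f(2) that plane_site_sites plane_site_eq_iff by (auto dest!: inj_onD)
  have unit: "l1_norm D (\<lambda>m. ?F i j m - ?F i' j' m) = 1" if "\<bar>i - i'\<bar> + \<bar>j - j'\<bar> = 1" for i j i' j'
  proof -
    have "l1_norm D (\<lambda>m. ?F i j m - ?F i' j' m) \<le> 1"
      using f(1) that plane_site_sites l1_norm_plane_site unfolding lip_def by fastforce
    moreover have "l1_norm D (\<lambda>m. ?F i j m - ?F i' j' m) \<noteq> 0"
    proof
      assume "l1_norm D (\<lambda>m. ?F i j m - ?F i' j' m) = 0"
      then have "?F i j m = ?F i' j' m" if "m < D" for m
        using l1_norm_component_le[OF that, of "\<lambda>m. ?F i j m - ?F i' j' m"] by linarith
      then have "?F i j = ?F i' j'" by (intro sites_eqI[OF F F]) auto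
      moreover have "(i, j) \<noteq> (i', j')" using that by auto
      ultimately show False using inj by blast
    qed
    ultimately show ?thesis using l1_norm_nonneg[of D "\<lambda>m. ?F i j m - ?F i' j' m"] by linarith
  qed
  have square: "?F (i + 1) j m - ?F i j m = ?F (i + 1) (j + 1) m - ?F i (j + 1) m" for i j
    by (rule parallelogram_of_unit_square[OF F F F F inj inj unit unit unit unit m]) auto
  have row: "?F (i + 1) (int j) m - ?F i (int j) m = ?F (i + 1) 0 m - ?F i 0 m" for i j
  proof (induction j)
    case (Suc j)
    then show ?case using square[of i "int j"] by (simp add: add.commute)
  qed simp
  show ?thesis
  proof (induction i)
    case (Suc i)
    then show ?case using row[of "int i" j] by (simp add: add.commute)
  qed simp
qed

text \<open>
  The paths \<open>f (i, 0)\<close> and \<open>f (0, j)\<close> with \<open>i, j \<le> n\<close> stay in the cube of radius \<open>n\<close> around \<open>f (0, 0)\<close>,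
  which bounds the number of candidates for the image of the square by \<open>(2 n + 1) ^ (2 D (n + 1))\<close>,
  whereas each candidate is open with probability \<open>p ^ (n + 1)\<^sup>2\<close>.
\<close>

lemma lip_prob_eq_0_plane:
  assumes p: "0 \<le> p" "p < 1"
  shows "lip_prob 2 D 1 p = 0"
proof -
  define A where "A = (\<lambda>n v (g, h). (\<lambda>(i, j). \<lambda>m\<in>{..<D}. g i m + h j m - v m :: int) ` ({..n::nat} \<times> {..n::nat}))"
  define Q where "Q = (\<lambda>v n. ({..n} \<rightarrow>\<^sub>E cube D v n) \<times> ({..n} \<rightarrow>\<^sub>E cube D v n))"
  define \<A> where "\<A> = (\<lambda>v n. {X \<in> A n v ` Q v n. card X = (n + 1)\<^sup>2})"
  define U where "U = (\<lambda>v n. {\<omega> \<in> space (percolation D p). \<exists>X\<in>\<A> v n. \<forall>x\<in>X. \<omega> x = True})"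
  define a where "a = (\<lambda>n. (real (2 * n + 1) ^ (2 * D) * p ^ (n + 1)) ^ (n + 1))"
  have finQ: "finite (Q v n)" for v n unfolding Q_def by (auto intro!: finite_PiE finite_cube)
  have cardQ: "card (Q v n) = ((2 * n + 1) ^ (2 * D)) ^ (n + 1)" for v n
    unfolding Q_def by (simp add: card_cartesian_product card_PiE card_cube power_mult_distrib
      flip: power_mult power_add mult_2) (simp add: mult_ac)
  have fin: "finite (\<A> v n)" and card: "card (\<A> v n) \<le> ((2 * n + 1) ^ (2 * D)) ^ (n + 1)" for v n
  proof -
    show "finite (\<A> v n)" unfolding \<A>_def using finQ by auto
    have "card (\<A> v n) \<le> card (A n v ` Q v n)"
      unfolding \<A>_def using finQ by (intro card_mono) auto
    also have "\<dots> \<le> card (Q v n)" using finQ by (rule card_image_le)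
    finally show "card (\<A> v n) \<le> ((2 * n + 1) ^ (2 * D)) ^ (n + 1)" unfolding cardQ .
  qed
  have X: "X \<subseteq> sites D \<and> finite X \<and> (n + 1)\<^sup>2 \<le> card X"
    if X: "X \<in> \<A> v n" for X v n
  proof -
    obtain g h where gh: "X = A n v (g, h)" "card X = (n + 1)\<^sup>2"
      using X unfolding \<A>_def by auto
    have "(\<lambda>m\<in>{..<D}. g i m + h j m - v m) \<in> sites D" for i j unfolding sites_def by auto
    then have "X \<subseteq> sites D" unfolding gh(1) A_def by auto
    moreover have "finite X" unfolding gh(1) A_def by auto
    ultimately show ?thesis using gh(2) by simp
  qed
  show ?thesis
  proof (rule lip_prob_eq_0I)
    show "U v n \<in> sets (percolation D p)" for v n
      unfolding U_def using fin X p by (intro union_bound(1)) auto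
    show "measure (percolation D p) (U v n) \<le> a n" for v n
    proof -
      have "measure (percolation D p) (U v n) \<le> card (\<A> v n) * p ^ (n + 1)\<^sup>2"
        unfolding U_def using union_bound(2)[of "\<A> v n" p D "(n + 1)\<^sup>2" True] fin X p by auto
      also have "\<dots> \<le> real (((2 * n + 1) ^ (2 * D)) ^ (n + 1)) * p ^ (n + 1)\<^sup>2"
        using card[of v n] p by (intro mult_right_mono of_nat_mono) auto
      also have "\<dots> = a n"
        unfolding a_def of_nat_power power_mult_distrib power2_eq_square
        by (simp only: power_mult[of p])
      finally show ?thesis .
    qed
    show "\<omega> \<in> U (f (origin 2)) n"
      if \<omega>: "\<omega> \<in> space (percolation D p)" and f: "f \<in> embeddings 2 D 1 \<omega>" for \<omega> f n
    proof -
      have f: "lip 2 D 1 f" "inj_on f (sites 2)" "f ` sites 2 \<subseteq> open_sites D \<omega>"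
        using f unfolding embeddings_def by auto
      have o: "origin 2 = plane_site 0 0" unfolding origin_def plane_site_def by auto
      define v where "v = f (origin 2)"
      define g where "g = (\<lambda>i\<in>{..n}. f (plane_site (int i) 0))"
      define h where "h = (\<lambda>j\<in>{..n}. f (plane_site 0 (int j)))"
      have S: "f (plane_site i j) \<in> sites D" for i j
        using f(1) plane_site_sites unfolding lip_def by auto
      have c: "f (plane_site i j) \<in> cube D v n" if "\<bar>i\<bar> + \<bar>j\<bar> \<le> int n" for i j
      proof (rule in_cubeI_l1[OF S])
        show "l1_norm D (\<lambda>m. f (plane_site i j) m - v m) \<le> int n"
          using lip_bound[OF f(1) plane_site_sites plane_site_sites, of i j 0 0] that
          unfolding v_def o l1_norm_plane_site by simp
      qed
      have gh: "(g, h) \<in> Q v n"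
        unfolding Q_def g_def h_def using c by auto
      have pt: "(\<lambda>m\<in>{..<D}. g i m + h j m - v m) = f (plane_site (int i) (int j))"
        if ij: "i \<le> n" "j \<le> n" for i j
      proof (rule sites_eqI[OF _ S])
        show "(\<lambda>m\<in>{..<D}. g i m + h j m - v m) \<in> sites D" unfolding sites_def by auto
        show "(\<lambda>m\<in>{..<D}. g i m + h j m - v m) m = f (plane_site (int i) (int j)) m" if "m < D" for m
          using one_lip_injection_splits[OF f(1,2) that, of i j] ij that
          unfolding g_def h_def v_def o by simp
      qed
      have eq: "A n v (g, h) = (\<lambda>(i, j). f (plane_site (int i) (int j))) ` ({..n} \<times> {..n})"
        unfolding A_def prod.case by (intro image_cong refl) (auto simp: pt)
      have "inj_on (\<lambda>(i, j). f (plane_site (int i) (int j))) ({..n} \<times> {..n})"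
        using inj_on_eq_iff[OF f(2) plane_site_sites plane_site_sites] plane_site_eq_iff
        by (auto simp: inj_on_def)
      then have "card (A n v (g, h)) = (n + 1)\<^sup>2"
        unfolding eq by (subst card_image) (auto simp: card_cartesian_product power2_eq_square)
      then have "A n v (g, h) \<in> \<A> v n" using gh unfolding \<A>_def by auto
      moreover have "\<forall>x\<in>A n v (g, h). \<omega> x = True"
        using f(3) plane_site_sites unfolding eq open_sites_def by auto
      ultimately show ?thesis using \<omega> unfolding U_def v_def by blast
    qed
    show "a \<longlonglongrightarrow> 0"
    proof -
      have "(\<lambda>n. 2 ^ (2 * D) * (real (n + 1) ^ (2 * D) * p ^ (n + 1))) \<longlonglongrightarrow> 2 ^ (2 * D) * 0"
        using LIMSEQ_ignore_initial_segment[OF poly_times_geometric_tendsto_0[OF p, of "2 * D"], of 1]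
        by (intro tendsto_mult tendsto_const) simp
      then have "\<forall>\<^sub>F n in sequentially. 2 ^ (2 * D) * (real (n + 1) ^ (2 * D) * p ^ (n + 1)) < 1 / 2"
        by (rule order_tendstoD) simp
      then have "\<forall>\<^sub>F n in sequentially. norm (a n) \<le> (1 / 2) ^ (n + 1)"
      proof eventually_elim
        case (elim n)
        have "real (2 * n + 1) ^ (2 * D) \<le> (2 * real (n + 1)) ^ (2 * D)"
          by (intro power_mono) auto
        then have "real (2 * n + 1) ^ (2 * D) * p ^ (n + 1) \<le> (2 * real (n + 1)) ^ (2 * D) * p ^ (n + 1)"
          using p by (intro mult_right_mono) auto
        also have "\<dots> \<le> 1 / 2" using elim by (simp only: power_mult_distrib mult.assoc)
        finally have le: "real (2 * n + 1) ^ (2 * D) * p ^ (n + 1) \<le> 1 / 2" .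
        have "0 \<le> real (2 * n + 1) ^ (2 * D) * p ^ (n + 1)" using p by simp
        then have "0 \<le> a n" "a n \<le> (1 / 2) ^ (n + 1)"
          unfolding a_def using le by (auto intro!: power_mono simp del: power_Suc)
        then show ?case by simp
      qed
      moreover have "(\<lambda>n. (1 / 2 :: real) ^ (n + 1)) \<longlonglongrightarrow> 0"
        using LIMSEQ_ignore_initial_segment[OF LIMSEQ_power_zero[of "1 / 2 :: real"], of 1] by simp
      ultimately show ?thesis by (rule Lim_null_comparison)
    qed
  qed
qed

section \<open>A monochromatic crossing of the box\<close>

definition grid :: "nat \<Rightarrow> nat \<Rightarrow> (nat \<Rightarrow> nat) set" where
  "grid d n = {x. \<forall>j<d. x j \<le> n}"

definition sup_close :: "nat \<Rightarrow> nat \<Rightarrow> (nat \<Rightarrow> nat) \<Rightarrow> (nat \<Rightarrow> nat) \<Rightarrow> bool" where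
  "sup_close d k x y \<longleftrightarrow> (\<forall>j<d. x j \<le> y j + k \<and> y j \<le> x j + k)"

definition steps :: "nat \<Rightarrow> nat \<Rightarrow> ((nat \<Rightarrow> nat) \<Rightarrow> nat) \<Rightarrow> nat \<Rightarrow> ((nat \<Rightarrow> nat) \<times> (nat \<Rightarrow> nat)) set" where
  "steps d n col i = {(x, y). x \<in> grid d n \<and> y \<in> grid d n \<and> col x = i \<and> col y = i \<and> sup_close d 2 x y}"

text \<open>
  Suppose there is no crossing, and let \<open>E i\<close> be the part of colour \<open>i\<close> that is connected to the face
  \<open>x i \<le> 1\<close>. Label a site \<open>y\<close> in direction \<open>i\<close> by 0 if it lies on the face \<open>y i = 0\<close> or next
  to \<open>E i\<close>, and by 1 otherwise. These labels satisfy the hypotheses of Kuhn's lemma, so there is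
  a unit cube in which the labels of every direction change. Take \<open>i\<close> to be the colour
  of its lowest corner \<open>q\<close>. If some corner has label 0 in direction \<open>i\<close>, then \<open>q\<close> is within distance 2
  of \<open>E i\<close> or close to the face and hence belongs to \<open>E i\<close>; but then all corners of the cube have label 0.
  Jumps of length 2 in \<open>steps\<close> are needed for the first of these two conclusions.
\<close>

lemma monochromatic_crossing:
  assumes n: "0 < n" and col: "\<And>x. x \<in> grid d n \<Longrightarrow> col x < d"
  shows "\<exists>i a b. i < d \<and> a \<in> grid d n \<and> a i \<le> 1 \<and> n \<le> b i + 1 \<and> (a, b) \<in> (steps d n col i)\<^sup>* \<and> col a = i"
proof (rule ccontr)
  assume contra: "\<not> ?thesis"
  define E where "E = (\<lambda>i. {b. \<exists>a. a \<in> grid d n \<and> col a = i \<and> a i \<le> 1 \<and> (a, b) \<in> (steps d n col i)\<^sup>*})"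
  have E_box: "b \<in> grid d n \<and> col b = i" if "b \<in> E i" for b i
  proof -
    obtain a where a: "a \<in> grid d n" "col a = i" "(a, b) \<in> (steps d n col i)\<^sup>*"
      using \<open>b \<in> E i\<close> unfolding E_def by auto
    from a(3) a(1,2) show ?thesis by (cases rule: rtranclE) (auto simp: steps_def)
  qed
  have E_far: "b i + 1 < n" if "b \<in> E i" "i < d" for b i
  proof (rule ccontr)
    assume "\<not> b i + 1 < n"
    then have "n \<le> b i + 1" by simp
    then show False using contra that unfolding E_def by blast
  qed
  have E_step: "y \<in> E i" if x: "x \<in> E i" and y: "y \<in> grid d n" "col y = i" "sup_close d 2 x y" for x y i
  proof -
    have "(x, y) \<in> steps d n col i" using E_box[OF x] y unfolding steps_def by auto
    then show ?thesis using x unfolding E_def by (auto intro: rtrancl_into_rtrancl)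
  qed
  \<comment> \<open>The labelling to which Kuhn's lemma is applied.\<close>
  define lab :: "(nat \<Rightarrow> nat) \<Rightarrow> nat \<Rightarrow> nat" where
    "lab = (\<lambda>y i. if y i = 0 \<or> (\<exists>z\<in>E i. sup_close d 1 z y) then 0 else 1)"
  have k1: "\<forall>x. (\<forall>i<d. x i \<le> n) \<longrightarrow> (\<forall>i<d. lab x i = 0 \<or> lab x i = 1)"
    and k2: "\<forall>x. (\<forall>i<d. x i \<le> n) \<longrightarrow> (\<forall>i<d. x i = 0 \<longrightarrow> lab x i = 0)"
    unfolding lab_def by auto
  have k3: "\<forall>x. (\<forall>i<d. x i \<le> n) \<longrightarrow> (\<forall>i<d. x i = n \<longrightarrow> lab x i = 1)"
  proof (intro allI impI)
    fix x i assume i: "i < d" "x i = n"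
    have "\<not> sup_close d 1 z x" if "z \<in> E i" for z
      using E_far[OF that i(1)] i unfolding sup_close_def by auto
    then show "lab x i = 1" using i n unfolding lab_def by auto
  qed
  obtain q where q: "\<forall>i<d. q i < n"
    and rs: "\<forall>i<d. \<exists>r s. (\<forall>j<d. q j \<le> r j \<and> r j \<le> q j + 1) \<and>
        (\<forall>j<d. q j \<le> s j \<and> s j \<le> q j + 1) \<and> lab r i \<noteq> lab s i"
    using kuhn_lemma[OF n k1 k2 k3] by metis
  define i where "i = col q"
  have qb: "q \<in> grid d n" unfolding grid_def using q by (auto intro: less_imp_le)
  have i: "i < d" unfolding i_def by (rule col[OF qb])
  have zero_imp: "q \<in> E i" if r: "\<forall>j<d. q j \<le> r j \<and> r j \<le> q j + 1" and l: "lab r i = 0" for r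
  proof (cases "r i = 0")
    case True
    then have "q i \<le> 1" using r i by force
    then show ?thesis unfolding E_def i_def using qb i_def by auto
  next
    case False
    then obtain z where z: "z \<in> E i" "sup_close d 1 z r" using l unfolding lab_def by (auto split: if_splits)
    have "sup_close d 2 z q" unfolding sup_close_def
    proof (intro allI impI)
      fix j assume "j < d"
      then show "z j \<le> q j + 2 \<and> q j \<le> z j + 2" using z(2) r unfolding sup_close_def by fastforce
    qed
    then show ?thesis using E_step[OF z(1) qb] i_def by auto
  qed
  have imp_zero: "lab r i = 0" if r: "\<forall>j<d. q j \<le> r j \<and> r j \<le> q j + 1" and "q \<in> E i" for r
  proof -
    have "sup_close d 1 q r" unfolding sup_close_def using r by force
    then show ?thesis using that(2) unfolding lab_def by auto
  qed
  obtain r s where r: "\<forall>j<d. q j \<le> r j \<and> r j \<le> q j + 1" and s: "\<forall>j<d. q j \<le> s j \<and> s j \<le> q j + 1"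
    and ne: "lab r i \<noteq> lab s i" using rs i by blast
  have "lab r i = 0 \<or> lab s i = 0" using ne unfolding lab_def by (auto split: if_splits)
  then have "q \<in> E i" using zero_imp r s by blast
  then show False using imp_zero[OF r] imp_zero[OF s] ne by simp
qed

text \<open>
  A crossing with jumps of length at most 2 visits one of any two adjacent levels, and a label
  that is constant on components is constant along it.
\<close>

lemma long_component:
  fixes lab :: "(nat \<Rightarrow> nat) \<Rightarrow> 'b"
  assumes n: "0 < n" and col: "\<And>x. x \<in> grid d n \<Longrightarrow> col x < d"
    and lab: "\<And>x y. x \<in> grid d n \<Longrightarrow> y \<in> grid d n \<Longrightarrow> sup_close d 2 x y \<Longrightarrow> col x = col y \<Longrightarrow> lab x = lab y"
  shows "\<exists>c. \<exists>i<d. \<forall>t. 1 \<le> t \<longrightarrow> t < n \<longrightarrow> (\<exists>x\<in>grid d n. lab x = c \<and> (x i = t \<or> x i = t + 1))"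
proof -
  obtain i a b where i: "i < d" "a \<in> grid d n" "a i \<le> 1" "n \<le> b i + 1" "col a = i"
    and ab: "(a, b) \<in> (steps d n col i)\<^sup>*"
    using monochromatic_crossing[of n d col, OF n col] by blast
  have "b \<in> grid d n \<and> lab b = lab a \<and>
     (\<forall>t. a i \<le> t \<longrightarrow> t \<le> b i \<longrightarrow> (\<exists>x\<in>grid d n. lab x = lab a \<and> (x i = t \<or> x i = t + 1)))"
    using ab
  proof (induction rule: rtrancl_induct)
    case base
    then show ?case using i(2) by force
  next
    case (step y z)
    have yz: "y \<in> grid d n" "z \<in> grid d n" "sup_close d 2 y z" "col y = col z"
      using step.hyps(2) unfolding steps_def by auto
    have lz: "lab z = lab a" using lab[OF yz] step.IH by simp
    have "z i \<le> y i + 2" using yz(3) i(1) unfolding sup_close_def by auto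
    then have "\<exists>x\<in>grid d n. lab x = lab a \<and> (x i = t \<or> x i = t + 1)" if "a i \<le> t" "t \<le> z i" for t
    proof (cases "t \<le> y i")
      case True
      then show ?thesis using step.IH that by blast
    next
      case False
      then have "z i = t \<or> z i = t + 1" using \<open>z i \<le> y i + 2\<close> that by linarith
      then show ?thesis using yz(2) lz by blast
    qed
    then show ?case using yz(2) lz by blast
  qed
  moreover have "a i \<le> t \<and> t \<le> b i" if "1 \<le> t" "t < n" for t using that i(3,4) by auto
  ultimately show ?thesis using i(1) by blast
qed

section \<open>Colouring the neighbourhood of a codimension-one skeleton\<close>

definition zdist :: "real \<Rightarrow> real" where
  "zdist t = \<bar>t - of_int (round t)\<bar>"

lemma zdist_le: "zdist t \<le> \<bar>t - of_int m\<bar>"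
  unfolding zdist_def by (rule round_diff_minimal)

lemma zdist_diff_le: "zdist t \<le> zdist s + \<bar>t - s\<bar>"
  using zdist_le[of t "round s"] unfolding zdist_def by linarith

text \<open>
  The directions in which \<open>z\<close> is close to a hyperplane of integer points. If \<open>j\<close> of them are close at the
  scale \<open>j \<delta>\<close>, then \<open>z\<close> is close to the skeleton of codimension \<open>j\<close> of the tiling by unit cubes.
\<close>

definition thick_face :: "nat \<Rightarrow> real \<Rightarrow> (nat \<Rightarrow> real) \<Rightarrow> nat \<Rightarrow> nat set" where
  "thick_face d \<delta> z j = {i. i < d \<and> zdist (z i) \<le> real j * \<delta>}"

text \<open>
  The colour is the largest codimension whose skeleton is close. The neighbourhoods get thicker with the
  codimension, so that two faces of the same dimension can meet only inside the neighbourhood of a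
  face of smaller dimension, where the colour is different.
\<close>

definition skeleton_colour :: "nat \<Rightarrow> real \<Rightarrow> (nat \<Rightarrow> real) \<Rightarrow> nat" where
  "skeleton_colour d \<delta> z = Max {j. j \<in> {1..d} \<and> j \<le> card (thick_face d \<delta> z j)}"

text \<open>
  Twice the centre of the face of the tiling to which \<open>z\<close> is close: the integer hyperplane in the
  directions of the thick face, and the midpoint of a unit interval in the other directions.
\<close>

definition skeleton_label :: "nat \<Rightarrow> real \<Rightarrow> (nat \<Rightarrow> real) \<Rightarrow> nat \<Rightarrow> int" where
  "skeleton_label d \<delta> z = (\<lambda>i\<in>{..<d}.
     if i \<in> thick_face d \<delta> z (skeleton_colour d \<delta> z) then 2 * round (z i) else 2 * \<lfloor>z i\<rfloor> + 1)"

lemma finite_thick_face: "finite (thick_face d \<delta> z j)"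
  unfolding thick_face_def by auto

lemma card_thick_face_le: "card (thick_face d \<delta> z j) \<le> d"
proof -
  have "card (thick_face d \<delta> z j) \<le> card {..<d}"
    by (rule card_mono) (auto simp: thick_face_def)
  then show ?thesis by simp
qed

lemma thick_face_neighbour:
  assumes "\<And>i. i < d \<Longrightarrow> \<bar>z i - z' i\<bar> \<le> \<delta>"
  shows "thick_face d \<delta> z' j \<subseteq> thick_face d \<delta> z (Suc j)"
proof
  fix i assume i: "i \<in> thick_face d \<delta> z' j"
  then show "i \<in> thick_face d \<delta> z (Suc j)"
    using zdist_diff_le[of "z i" "z' i"] assms[of i] unfolding thick_face_def
    by (auto simp: algebra_simps)
qed

text \<open>
  Having an integer coordinate is what excludes the colour 0, so that \<open>d\<close> colours suffice. Maximality of
  the colour \<open>c\<close> forces exactly \<open>c\<close> close directions.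
\<close>

lemma skeleton_colour:
  assumes \<delta>: "0 < \<delta>" and int: "i < d" "z i = of_int m"
  shows "skeleton_colour d \<delta> z \<in> {1..d}"
    "card (thick_face d \<delta> z (skeleton_colour d \<delta> z)) = skeleton_colour d \<delta> z"
    "Suc (skeleton_colour d \<delta> z) \<le> d \<Longrightarrow>
       card (thick_face d \<delta> z (Suc (skeleton_colour d \<delta> z))) \<le> skeleton_colour d \<delta> z"
proof -
  let ?c = "skeleton_colour d \<delta> z" and ?S = "{j. j \<in> {1..d} \<and> j \<le> card (thick_face d \<delta> z j)}"
  have "zdist (z i) = 0" using zdist_le[of "z i" m] int(2) unfolding zdist_def by simp
  then have "i \<in> thick_face d \<delta> z 1" using int(1) \<delta> unfolding thick_face_def by auto
  then have "card (thick_face d \<delta> z 1) \<noteq> 0" using finite_thick_face[of d \<delta> z 1] by auto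
  then have "1 \<in> ?S" using int(1) by auto
  then have c: "?c \<in> ?S" unfolding skeleton_colour_def by (intro Max_in) auto
  show 1: "?c \<in> {1..d}" using c by auto
  show 2: "card (thick_face d \<delta> z (Suc ?c)) \<le> ?c" if "Suc ?c \<le> d"
  proof (rule ccontr)
    assume "\<not> ?thesis"
    then have "Suc ?c \<in> ?S" using that by auto
    then have "Suc ?c \<le> ?c" unfolding skeleton_colour_def by (intro Max_ge) auto
    then show False by simp
  qed
  show "card (thick_face d \<delta> z ?c) = ?c"
  proof (cases "Suc ?c \<le> d")
    case True
    have "thick_face d \<delta> z ?c \<subseteq> thick_face d \<delta> z (Suc ?c)"
      using \<delta> by (intro thick_face_neighbour) auto
    then have "card (thick_face d \<delta> z ?c) \<le> card (thick_face d \<delta> z (Suc ?c))"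
      by (intro card_mono finite_thick_face)
    then show ?thesis using 2[OF True] c by auto
  next
    case False
    then show ?thesis using c card_thick_face_le[of d \<delta> z ?c] by auto
  qed
qed

text \<open>
  Both thick faces have \<open>c\<close> elements, where \<open>c\<close> is the common colour, and both are contained in the
  thick face of \<open>z\<close> at the next scale, which has at most \<open>c\<close> elements; if \<open>c = d\<close>, both
  consist of all directions. Hence they agree. In
  their directions the nearest integers agree because \<open>(2 c + 1) \<delta> < 1\<close>, and in the other directions
  both points are further than \<open>\<delta>\<close> from the integers and cannot be separated by one.
\<close>

lemma skeleton_label_eq:
  assumes \<delta>: "0 < \<delta>" "4 * real d * \<delta> \<le> 1"
    and int: "i0 < d" "z i0 = of_int m" "i0' < d" "z' i0' = of_int m'"
    and close: "\<And>i. i < d \<Longrightarrow> \<bar>z i - z' i\<bar> \<le> \<delta>"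
    and same: "skeleton_colour d \<delta> z = skeleton_colour d \<delta> z'"
  shows "skeleton_label d \<delta> z = skeleton_label d \<delta> z'"
proof -
  define c where "c = skeleton_colour d \<delta> z"
  note c = skeleton_colour[of \<delta> i0 d z m, OF \<delta>(1) int(1,2), folded c_def]
  note c' = skeleton_colour[of \<delta> i0' d z' m', OF \<delta>(1) int(3,4), folded same, folded c_def]
  let ?J = "thick_face d \<delta> z c" and ?J' = "thick_face d \<delta> z' c"
  have J: "?J = ?J'"
  proof (cases "Suc c \<le> d")
    case True
    have "?J \<subseteq> thick_face d \<delta> z (Suc c)" "?J' \<subseteq> thick_face d \<delta> z (Suc c)"
      using \<delta>(1) close by (simp_all add: thick_face_neighbour)
    then have "card (?J \<union> ?J') \<le> c"
      using c(3)[OF True] card_mono[OF finite_thick_face, of "?J \<union> ?J'" d \<delta> z "Suc c"] by auto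
    then have "card (?J \<union> ?J') = card ?J" "card (?J \<union> ?J') = card ?J'"
      using c(2) c'(2) card_mono[of "?J \<union> ?J'" ?J] card_mono[of "?J \<union> ?J'" ?J'] finite_thick_face
      by auto
    then show ?thesis using card_subset_eq[of "?J \<union> ?J'" ?J] card_subset_eq[of "?J \<union> ?J'" ?J']
        finite_thick_face by auto
  next
    case False
    then have "c = d" using c(1) by auto
    moreover have "?J \<subseteq> {..<d}" "?J' \<subseteq> {..<d}" unfolding thick_face_def by auto
    ultimately show ?thesis
      using c(2) c'(2) card_subset_eq[of "{..<d}" ?J] card_subset_eq[of "{..<d}" ?J'] by auto
  qed
  have cd: "1 \<le> real c" "real c \<le> real d" using c(1) by auto
  have "real c * \<delta> \<le> real d * \<delta>" "1 * \<delta> \<le> real c * \<delta>"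
    using \<delta>(1) by (intro mult_right_mono cd; simp)+
  then have c\<delta>: "real c * \<delta> \<le> 1 / 4" "\<delta> \<le> real c * \<delta>"
    using \<delta>(2) by (linarith, linarith)
  have "(if i \<in> ?J then 2 * round (z i) else 2 * \<lfloor>z i\<rfloor> + 1)
      = (if i \<in> ?J then 2 * round (z' i) else 2 * \<lfloor>z' i\<rfloor> + 1)" if i: "i < d" for i
  proof (cases "i \<in> ?J")
    case True
    then have "i \<in> ?J'" using J by simp
    with True have "zdist (z i) \<le> real c * \<delta>" "zdist (z' i) \<le> real c * \<delta>"
      unfolding thick_face_def by simp_all
    then have "\<bar>z i - of_int (round (z i))\<bar> \<le> 1 / 4" "\<bar>z' i - of_int (round (z' i))\<bar> \<le> 1 / 4"
      using c\<delta>(1) unfolding zdist_def by linarith+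
    then have "\<bar>of_int (round (z i)) - of_int (round (z' i))\<bar> < (1 :: real)"
      using close[OF i] c\<delta> by linarith
    then have "round (z i) = round (z' i)" by linarith
    then show ?thesis using True by simp
  next
    case False
    then have "i \<notin> ?J'" using J by simp
    with False have "zdist (z i) > real c * \<delta>" "zdist (z' i) > real c * \<delta>"
      using i unfolding thick_face_def by simp_all
    then have far: "zdist (z i) > \<delta>" "zdist (z' i) > \<delta>" using c\<delta>(2) by linarith+
    have "\<lfloor>z i\<rfloor> = \<lfloor>z' i\<rfloor>"
    proof (rule ccontr)
      assume "\<lfloor>z i\<rfloor> \<noteq> \<lfloor>z' i\<rfloor>"
      then have "\<lfloor>z i\<rfloor> < \<lfloor>z' i\<rfloor> \<or> \<lfloor>z' i\<rfloor> < \<lfloor>z i\<rfloor>" by linarith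
      then show False
      proof
        assume "\<lfloor>z i\<rfloor> < \<lfloor>z' i\<rfloor>"
        then have "z i < of_int \<lfloor>z' i\<rfloor>" "of_int \<lfloor>z' i\<rfloor> \<le> z' i" by (auto simp: floor_less_iff)
        then show False
          using far zdist_le[of "z i" "\<lfloor>z' i\<rfloor>"] close[OF i] by linarith
      next
        assume "\<lfloor>z' i\<rfloor> < \<lfloor>z i\<rfloor>"
        then have "z' i < of_int \<lfloor>z i\<rfloor>" "of_int \<lfloor>z i\<rfloor> \<le> z i" by (auto simp: floor_less_iff)
        then show False
          using far zdist_le[of "z' i" "\<lfloor>z i\<rfloor>"] close[OF i] by linarith
      qed
    qed
    then show ?thesis using False by simp
  qed
  then show ?thesis
    unfolding skeleton_label_def same[symmetric] c_def[symmetric] J[symmetric]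
    by (intro restrict_ext) auto
qed

lemma skeleton_label_close:
  assumes "i < d"
  shows "\<bar>2 * z i - of_int (skeleton_label d \<delta> z i)\<bar> \<le> 1"
proof -
  have "\<bar>of_int (round (z i)) - z i\<bar> \<le> 1 / 2" by (rule of_int_round_abs_le)
  moreover have "of_int \<lfloor>z i\<rfloor> \<le> z i" "z i \<le> of_int \<lfloor>z i\<rfloor> + 1" by linarith+
  ultimately have "\<bar>2 * z i - of_int (2 * round (z i))\<bar> \<le> 1"
    "\<bar>2 * z i - of_int (2 * \<lfloor>z i\<rfloor> + 1)\<bar> \<le> 1"
    by linarith+
  then show ?thesis using assms unfolding skeleton_label_def by simp
qed

section \<open>Radial projection of a punctured cube\<close>

text \<open>
  The position of \<open>t\<close> in the interval from \<open>k\<close> to \<open>k + 1\<close> as seen from the centre \<open>h\<close>, scaled to be 0 at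
  the centre and 1 at both ends.
\<close>

definition wall_ratio :: "int \<Rightarrow> real \<Rightarrow> real \<Rightarrow> real" where
  "wall_ratio k h t = max ((t - h) / (of_int k + 1 - h)) ((h - t) / (h - of_int k))"

text \<open>
  The Minkowski gauge of the unit cube with lowest corner \<open>k\<close>, taken with respect to the centre \<open>h\<close>.
\<close>

definition gauge_at :: "nat \<Rightarrow> (nat \<Rightarrow> int) \<Rightarrow> (nat \<Rightarrow> real) \<Rightarrow> (nat \<Rightarrow> real) \<Rightarrow> real" where
  "gauge_at d k h x = Max ((\<lambda>i. wall_ratio (k i) (h i) (x i)) ` {..<d})"

text \<open>
  The radial projection of the cube from \<open>h\<close> to its boundary. It fixes the boundary for every choice
  of \<open>h\<close>, so the projections of neighbouring cubes fit together even if their centres are placed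
  differently.
\<close>

definition radial :: "nat \<Rightarrow> (nat \<Rightarrow> int) \<Rightarrow> (nat \<Rightarrow> real) \<Rightarrow> (nat \<Rightarrow> real) \<Rightarrow> nat \<Rightarrow> real" where
  "radial d k h x i = h i + (x i - h i) / gauge_at d k h x"

text \<open>
  All slopes have absolute value between 1 and 4 because the centre has distance at least 1/4 from the walls.
\<close>

lemma wall_ratio_bounds:
  assumes h: "of_int k + 1 / 4 \<le> h" "h \<le> of_int k + 3 / 4"
  shows "\<bar>t - h\<bar> \<le> wall_ratio k h t"
    "of_int k \<le> t \<Longrightarrow> t \<le> of_int k + 1 \<Longrightarrow> wall_ratio k h t \<le> 1"
    "wall_ratio k h t \<le> wall_ratio k h s + 4 * \<bar>t - s\<bar>"
    "1 - 4 * (of_int k + 1 - t) \<le> wall_ratio k h t \<or> of_int k + 1 < t"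
    "1 - 4 * (t - of_int k) \<le> wall_ratio k h t \<or> t < of_int k"
proof -
  define a where "a = of_int k + 1 - h"
  define b where "b = h - of_int k"
  have ab: "1 / 4 \<le> a" "a \<le> 1" "1 / 4 \<le> b" "b \<le> 1" unfolding a_def b_def using h by auto
  have W: "wall_ratio k h t = max ((t - h) / a) ((h - t) / b)" for t
    unfolding wall_ratio_def a_def b_def by simp
  have inv: "1 \<le> 1 / a" "1 / a \<le> 4" "1 \<le> 1 / b" "1 / b \<le> 4"
    using ab by (auto simp: field_simps)
  have sc: "x \<le> x / a" "x \<le> x / b" "x / a \<le> 4 * x" "x / b \<le> 4 * x" if "0 \<le> x" for x
    using mult_left_mono[OF inv(1) that] mult_left_mono[OF inv(2) that]
      mult_left_mono[OF inv(3) that] mult_left_mono[OF inv(4) that] by auto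
  show "\<bar>t - h\<bar> \<le> wall_ratio k h t"
    unfolding W using sc(1)[of "t - h"] sc(2)[of "h - t"] by (cases "h \<le> t") auto
  show "wall_ratio k h t \<le> 1" if "of_int k \<le> t" "t \<le> of_int k + 1"
    unfolding W using ab that by (auto simp: a_def b_def divide_le_eq)
  have "(t - h) / a \<le> (s - h) / a + 4 * \<bar>t - s\<bar>" "(h - t) / b \<le> (h - s) / b + 4 * \<bar>t - s\<bar>"
  proof -
    have "(t - h) / a = (s - h) / a + (t - s) / a" by (simp add: diff_divide_distrib)
    moreover have "(t - s) / a \<le> \<bar>t - s\<bar> / a" using ab by (intro divide_right_mono) auto
    ultimately show "(t - h) / a \<le> (s - h) / a + 4 * \<bar>t - s\<bar>" using sc(3)[of "\<bar>t - s\<bar>"] by auto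
    have "(h - t) / b = (h - s) / b + (s - t) / b" by (simp add: diff_divide_distrib)
    moreover have "(s - t) / b \<le> \<bar>t - s\<bar> / b" using ab by (intro divide_right_mono) auto
    ultimately show "(h - t) / b \<le> (h - s) / b + 4 * \<bar>t - s\<bar>" using sc(4)[of "\<bar>t - s\<bar>"] by auto
  qed
  then show "wall_ratio k h t \<le> wall_ratio k h s + 4 * \<bar>t - s\<bar>" unfolding W by linarith
  show "1 - 4 * (of_int k + 1 - t) \<le> wall_ratio k h t \<or> of_int k + 1 < t"
  proof (cases "of_int k + 1 < t")
    case False
    then have "(of_int k + 1 - t) / a \<le> 4 * (of_int k + 1 - t)" by (intro sc) simp
    moreover have "(t - h) / a = 1 - (of_int k + 1 - t) / a"
    proof -
      have "t - h = a - (of_int k + 1 - t)" unfolding a_def by simp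
      then have "(t - h) / a = a / a - (of_int k + 1 - t) / a" by (simp only: diff_divide_distrib)
      then show ?thesis using ab(1) by simp
    qed
    ultimately show ?thesis unfolding W by linarith
  qed simp
  show "1 - 4 * (t - of_int k) \<le> wall_ratio k h t \<or> t < of_int k"
  proof (cases "t < of_int k")
    case False
    then have "(t - of_int k) / b \<le> 4 * (t - of_int k)" by (intro sc) simp
    moreover have "(h - t) / b = 1 - (t - of_int k) / b"
    proof -
      have "h - t = b - (t - of_int k)" unfolding b_def by simp
      then have "(h - t) / b = b / b - (t - of_int k) / b" by (simp only: diff_divide_distrib)
      then show ?thesis using ab(3) by simp
    qed
    ultimately show ?thesis unfolding W by linarith
  qed simp
qed

lemma wall_ratio_le_gauge:
  "i < d \<Longrightarrow> wall_ratio (k i) (h i) (x i) \<le> gauge_at d k h x"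
  unfolding gauge_at_def by (intro Max_ge) auto

lemma gauge_attained:
  assumes "0 < d"
  obtains i where "i < d" "gauge_at d k h x = wall_ratio (k i) (h i) (x i)"
proof -
  have "gauge_at d k h x \<in> (\<lambda>i. wall_ratio (k i) (h i) (x i)) ` {..<d}"
    unfolding gauge_at_def using assms by (intro Max_in) auto
  then show thesis using that by auto
qed

context
  fixes d :: nat and k :: "nat \<Rightarrow> int" and h :: "nat \<Rightarrow> real"
  assumes d: "0 < d"
    and h: "\<And>i. i < d \<Longrightarrow> of_int (k i) + 1 / 4 \<le> h i" "\<And>i. i < d \<Longrightarrow> h i \<le> of_int (k i) + 3 / 4"
begin

lemma centre_dist_le_gauge:
  assumes "i < d" shows "\<bar>x i - h i\<bar> \<le> gauge_at d k h x"
  using wall_ratio_bounds(1)[OF h(1)[OF assms] h(2)[OF assms], of "x i"]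
    wall_ratio_le_gauge[OF assms, of k h x] by linarith

lemma gauge_le_1:
  assumes "\<And>i. i < d \<Longrightarrow> of_int (k i) \<le> x i" "\<And>i. i < d \<Longrightarrow> x i \<le> of_int (k i) + 1"
  shows "gauge_at d k h x \<le> 1"
  by (rule gauge_attained[OF d, of k h x]) (use wall_ratio_bounds(2) h assms in auto)

lemma gauge_lipschitz:
  assumes "\<And>i. i < d \<Longrightarrow> \<bar>x i - y i\<bar> \<le> \<eta>"
  shows "gauge_at d k h x \<le> gauge_at d k h y + 4 * \<eta>"
proof -
  obtain i where i: "i < d" "gauge_at d k h x = wall_ratio (k i) (h i) (x i)"
    by (rule gauge_attained[OF d])
  have "gauge_at d k h x \<le> wall_ratio (k i) (h i) (y i) + 4 * \<bar>x i - y i\<bar>"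
    unfolding i(2) by (rule wall_ratio_bounds(3)[OF h(1)[OF i(1)] h(2)[OF i(1)]])
  also have "\<dots> \<le> gauge_at d k h y + 4 * \<eta>"
    by (intro add_mono mult_left_mono wall_ratio_le_gauge i(1) assms) simp
  finally show ?thesis .
qed

lemma radial_hits_wall:
  assumes "0 < gauge_at d k h x"
  obtains i m where "i < d" "radial d k h x i = of_int m"
proof -
  let ?g = "gauge_at d k h x"
  obtain i where i: "i < d" "?g = wall_ratio (k i) (h i) (x i)"
    by (rule gauge_attained[OF d])
  have pos: "of_int (k i) + 1 - h i > 0" "h i - of_int (k i) > 0" using h[OF i(1)] by auto
  consider "?g = (x i - h i) / (of_int (k i) + 1 - h i)" | "?g = (h i - x i) / (h i - of_int (k i))"
    using i(2) unfolding wall_ratio_def max_def by (auto split: if_splits)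
  then show thesis
  proof cases
    case 1
    then have "x i - h i = ?g * (of_int (k i) + 1 - h i)" using pos by simp
    then have "radial d k h x i = of_int (k i + 1)" unfolding radial_def using assms by simp
    then show thesis using that i(1) by blast
  next
    case 2
    then have "h i - x i = ?g * (h i - of_int (k i))" using pos by simp
    then have "x i - h i = ?g * (of_int (k i) - h i)" by (simp add: algebra_simps)
    then have "radial d k h x i = of_int (k i)" unfolding radial_def using assms by simp
    then show thesis using that i(1) by blast
  qed
qed

text \<open>
  Points near the walls are hardly moved, which allows points in different cubes to be compared.
\<close>

lemma radial_displacement:
  assumes "i < d" "0 < gauge_at d k h x" "gauge_at d k h x \<le> 1"
  shows "\<bar>radial d k h x i - x i\<bar> \<le> 1 - gauge_at d k h x"
proof -
  let ?g = "gauge_at d k h x"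
  have "radial d k h x i - x i = (x i - h i) * ((1 - ?g) / ?g)"
    unfolding radial_def using assms(2) by (simp add: field_simps)
  then have "\<bar>radial d k h x i - x i\<bar> = \<bar>x i - h i\<bar> * ((1 - ?g) / ?g)"
    using assms(2,3) by (simp add: abs_mult)
  also have "\<dots> \<le> ?g * ((1 - ?g) / ?g)"
    using assms centre_dist_le_gauge by (intro mult_right_mono) auto
  finally show ?thesis using assms(2) by simp
qed

text \<open>
  The projection is not Lipschitz at the centre. On the set where the gauge is at least \<open>\<sigma>\<close> it is
  Lipschitz with a constant of order \<open>1 / \<sigma>\<close>.
\<close>

lemma radial_lipschitz:
  assumes i: "i < d" and close: "\<And>i. i < d \<Longrightarrow> \<bar>x i - y i\<bar> \<le> \<eta>"
    and \<sigma>: "0 < \<sigma>" "\<sigma> \<le> gauge_at d k h x" "\<sigma> \<le> gauge_at d k h y"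
  shows "\<bar>radial d k h x i - radial d k h y i\<bar> \<le> 5 * \<eta> / \<sigma>"
proof -
  let ?g = "gauge_at d k h x" and ?g' = "gauge_at d k h y"
  have g: "0 < ?g" "0 < ?g'" using \<sigma> by auto
  have \<eta>: "0 \<le> \<eta>" using close[OF i] by linarith
  have "?g \<le> ?g' + 4 * \<eta>" "?g' \<le> ?g + 4 * \<eta>"
    using close by (auto intro!: gauge_lipschitz simp: abs_minus_commute)
  then have lip: "\<bar>?g' - ?g\<bar> \<le> 4 * \<eta>" by linarith
  have "radial d k h x i - radial d k h y i
      = (x i - y i) / ?g + (y i - h i) / ?g' * ((?g' - ?g) / ?g)"
    unfolding radial_def using g by (simp add: field_simps)
  then have "\<bar>radial d k h x i - radial d k h y i\<bar>
      \<le> \<bar>(x i - y i) / ?g\<bar> + \<bar>(y i - h i) / ?g'\<bar> * \<bar>(?g' - ?g) / ?g\<bar>"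
    by (metis abs_mult abs_triangle_ineq)
  also have "\<bar>(x i - y i) / ?g\<bar> \<le> \<eta> / \<sigma>"
    using g close[OF i] \<sigma> \<eta> by (auto simp: abs_divide intro!: frac_le)
  also have "\<bar>(y i - h i) / ?g'\<bar> * \<bar>(?g' - ?g) / ?g\<bar> \<le> 1 * (4 * \<eta> / \<sigma>)"
  proof (intro mult_mono)
    show "\<bar>(y i - h i) / ?g'\<bar> \<le> 1"
      using g centre_dist_le_gauge[OF i, of y] by (simp add: abs_divide divide_le_eq)
    show "\<bar>(?g' - ?g) / ?g\<bar> \<le> 4 * \<eta> / \<sigma>"
      using g lip \<sigma> \<eta> by (auto simp: abs_divide intro!: frac_le)
  qed auto
  finally show ?thesis using \<sigma>(1) by (simp add: field_simps)
qed

lemma gauge_near_wall: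
  assumes j: "j < d" and x: "of_int (k j) \<le> x j" "x j \<le> of_int (k j) + 1"
    and near: "x j - of_int (k j) \<le> \<eta> \<or> of_int (k j) + 1 - x j \<le> \<eta>"
  shows "1 - 4 * \<eta> \<le> gauge_at d k h x"
proof -
  have "1 - 4 * \<eta> \<le> wall_ratio (k j) (h j) (x j)"
    using wall_ratio_bounds(4,5)[OF h(1)[OF j] h(2)[OF j], of "x j"] near x by argo
  also have "\<dots> \<le> gauge_at d k h x" by (rule wall_ratio_le_gauge[OF j])
  finally show ?thesis .
qed

end

section \<open>Colouring a perforated lattice\<close>

definition cube_index :: "nat \<Rightarrow> nat \<Rightarrow> (nat \<Rightarrow> int) \<Rightarrow> nat \<Rightarrow> int" where
  "cube_index d K x = (\<lambda>i\<in>{..<d}. x i div int K)"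

text \<open>
  The colouring is that of the skeleton, composed with the radial projections. All lengths are scaled
  by \<open>1 / K\<close>. Two sites at distance \<open>R\<close> in the same cube are projected to points at distance at most
  \<open>5 R / r\<close>, where \<open>r = 36 d R\<close> is the radius of the holes; two such sites in different cubes are both close
  to walls and end up at distance at most \<open>9 R / K\<close>. The number 36 is chosen such that both bounds are
  at most the scale \<open>\<delta> = 1 / (4 d)\<close> of the colouring. The label confines each component to a cube of
  side \<open>3 K\<close>. The centre \<open>h k\<close> of the hole has to lie in the middle half of the cube with index \<open>k\<close>, so
  that the radial projection is controlled near the walls.
\<close>

lemma perforated_lattice_colouring:
  fixes d R K :: nat and h :: "(nat \<Rightarrow> int) \<Rightarrow> nat \<Rightarrow> int"
  assumes d: "0 < d" and R: "0 < R" and K: "36 * d * R \<le> K"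
    and centre: "\<And>x i. x \<in> G \<Longrightarrow> i < d \<Longrightarrow>
      int K \<le> 4 * (h (cube_index d K x) i - int K * cube_index d K x i) \<and>
      4 * (h (cube_index d K x) i - int K * cube_index d K x i) \<le> 3 * int K"
    and hole: "\<And>x. x \<in> G \<Longrightarrow> \<exists>i<d. int (36 * d * R) < \<bar>x i - h (cube_index d K x) i\<bar>"
  obtains col :: "(nat \<Rightarrow> int) \<Rightarrow> nat" and lab :: "(nat \<Rightarrow> int) \<Rightarrow> nat \<Rightarrow> int" where
    "\<And>x. x \<in> G \<Longrightarrow> col x < d"
    "\<And>x i. x \<in> G \<Longrightarrow> i < d \<Longrightarrow> \<bar>2 * x i - int K * lab x i\<bar> \<le> 3 * int K"
    "\<And>x. lab x \<in> sites d"
    "\<And>x y. x \<in> G \<Longrightarrow> y \<in> G \<Longrightarrow> (\<And>i. i < d \<Longrightarrow> \<bar>x i - y i\<bar> \<le> int R) \<Longrightarrow>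
       col x = col y \<Longrightarrow> lab x = lab y"
proof -
  have K0: "0 < K" using d R K by (metis less_le_trans mult_pos_pos zero_less_numeral)
  define r where "r = 36 * d * R"
  define \<delta> where "\<delta> = 1 / (4 * real d)"
  define \<sigma> where "\<sigma> = real r / real K"
  define \<eta> where "\<eta> = real R / real K"
  have \<delta>: "0 < \<delta>" "4 * real d * \<delta> \<le> 1" unfolding \<delta>_def using d by auto
  have \<sigma>: "0 < \<sigma>" "\<sigma> \<le> 1" unfolding \<sigma>_def r_def using d R K K0 by (auto simp del: of_nat_mult)
  have \<eta>\<sigma>: "9 * \<eta> / \<sigma> = \<delta>"
    unfolding \<eta>_def \<sigma>_def \<delta>_def r_def using d R K0 by (simp add: field_simps)
  have \<eta>0: "0 \<le> \<eta>" unfolding \<eta>_def by simp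
  have "9 * \<eta> * \<sigma> \<le> 9 * \<eta> * 1" using \<sigma>(2) \<eta>0 by (intro mult_left_mono) auto
  then have \<eta>\<delta>: "9 * \<eta> \<le> \<delta>" unfolding \<eta>\<sigma>[symmetric] using \<sigma>(1) by (simp add: field_simps)
  have "5 * \<eta> / \<sigma> \<le> 9 * \<eta> / \<sigma>" using \<eta>0 \<sigma>(1) by (intro divide_right_mono) auto
  then have \<eta>\<delta>': "5 * \<eta> / \<sigma> \<le> \<delta>" unfolding \<eta>\<sigma> .
  define k where "k = cube_index d K"
  define X where "X = (\<lambda>(x :: nat \<Rightarrow> int) i. real_of_int (x i) / real K)"
  define H where "H = (\<lambda>x i. real_of_int (h (k x) i) / real K)"
  define g where "g = (\<lambda>x. gauge_at d (k x) (H x) (X x))"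
  define z where "z = (\<lambda>x. radial d (k x) (H x) (X x))"
  have H: "of_int (k x i) + 1 / 4 \<le> H x i" "H x i \<le> of_int (k x i) + 3 / 4" if "x \<in> G" "i < d" for x i
  proof -
    have "real_of_int (int K) \<le> real_of_int (4 * (h (k x) i - int K * k x i))"
      "real_of_int (4 * (h (k x) i - int K * k x i)) \<le> real_of_int (3 * int K)"
      using centre[OF that] unfolding k_def[symmetric] by (simp_all only: of_int_le_iff)
    then show "of_int (k x i) + 1 / 4 \<le> H x i" "H x i \<le> of_int (k x i) + 3 / 4"
      unfolding H_def using K0 by (simp_all add: field_simps)
  qed
  have Xk: "of_int (k x i) \<le> X x i" "X x i \<le> of_int (k x i) + 1" if "i < d" for x i
  proof -
    have e: "k x i = x i div int K" unfolding k_def cube_index_def using that by simp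
    have "int K * k x i \<le> x i" "x i \<le> int K * k x i + int K"
      unfolding e using K0 pos_mod_bound[of "int K" "x i"] pos_mod_sign[of "int K" "x i"]
        mult_div_mod_eq[of "int K" "x i"] by linarith+
    then have "real_of_int (int K * k x i) \<le> real_of_int (x i)"
      "real_of_int (x i) \<le> real_of_int (int K * k x i + int K)" by (simp_all only: of_int_le_iff)
    then show "of_int (k x i) \<le> X x i" "X x i \<le> of_int (k x i) + 1"
      unfolding X_def using K0 by (simp_all add: field_simps)
  qed
  have g1: "g x \<le> 1" if "x \<in> G" for x
    unfolding g_def by (rule gauge_le_1[where k = "k x" and h = "H x" and x = "X x", OF d H[OF that] Xk])
  have g\<sigma>: "\<sigma> \<le> g x" if x: "x \<in> G" for x
  proof -
    obtain i where i: "i < d" "int r < \<bar>x i - h (k x) i\<bar>"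
      using hole[OF x] unfolding k_def r_def by blast
    have "real_of_int (int r) \<le> real_of_int \<bar>x i - h (k x) i\<bar>" using i(2) by (simp only: of_int_le_iff)
    then have "\<sigma> \<le> \<bar>X x i - H x i\<bar>"
      unfolding \<sigma>_def X_def H_def using K0
      by (simp add: diff_divide_distrib[symmetric] abs_divide divide_right_mono)
    also have "\<dots> \<le> g x" unfolding g_def by (rule centre_dist_le_gauge[where k = "k x" and h = "H x" and x = "X x", OF d H[OF x] i(1)])
    finally show ?thesis .
  qed
  have disp: "\<bar>z x i - X x i\<bar> \<le> 1 - g x" if "x \<in> G" "i < d" for x i
    using radial_displacement[where k = "k x" and h = "H x" and x = "X x", OF d H[OF that(1)] that(2)] g1[OF that(1)] g\<sigma>[OF that(1)] \<sigma>(1)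
    unfolding z_def g_def by linarith
  have wall: "\<exists>i m. i < d \<and> z x i = of_int m" if "x \<in> G" for x
  proof -
    have "0 < gauge_at d (k x) (H x) (X x)"
      using g\<sigma>[OF that] \<sigma>(1) unfolding g_def by linarith
    from radial_hits_wall[where k = "k x" and h = "H x" and x = "X x", OF d H[OF that] this]
    show ?thesis unfolding z_def by blast
  qed
  \<comment> \<open>The composition of scaling and projection does not separate sites at distance \<open>R\<close> by more than \<open>\<delta>\<close>.\<close>
  have near: "\<bar>z x i - z y i\<bar> \<le> \<delta>"
    if x: "x \<in> G" and y: "y \<in> G" and i: "i < d" and xy: "\<And>i. i < d \<Longrightarrow> \<bar>x i - y i\<bar> \<le> int R" for x y i
  proof -
    have XY: "\<bar>X x i - X y i\<bar> \<le> \<eta>" if "i < d" for i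
    proof -
      have "real_of_int \<bar>x i - y i\<bar> \<le> real_of_int (int R)" using xy[OF that] by (simp only: of_int_le_iff)
      then show ?thesis unfolding X_def \<eta>_def using K0
        by (simp add: diff_divide_distrib[symmetric] abs_divide divide_right_mono)
    qed
    show ?thesis
    proof (cases "\<forall>j<d. k x j = k y j")
      case True
      have "k x = k y" unfolding k_def cube_index_def
        by (rule restrict_ext) (use True in \<open>simp add: k_def cube_index_def\<close>)
      then have "H x = H y" unfolding H_def by simp
      have "\<bar>z x i - z y i\<bar> \<le> 5 * \<eta> / \<sigma>"
        using radial_lipschitz[where k = "k y" and h = "H y" and x = "X x" and y = "X y",
            OF d H[OF y] i XY \<sigma>(1)] g\<sigma>[OF x] g\<sigma>[OF y]
        unfolding z_def g_def \<open>k x = k y\<close> \<open>H x = H y\<close> by blast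
      then show ?thesis using \<eta>\<delta>' by linarith
    next
      case False
      then obtain j where j: "j < d" "k x j \<noteq> k y j" by auto
      have gap: "1 - 4 * \<eta> \<le> g x" "1 - 4 * \<eta> \<le> g y"
      proof -
        \<comment> \<open>Some wall separates the two sites, so each of them is within \<open>\<eta>\<close> of it.\<close>
        have kk: "real_of_int (k x j) + 1 \<le> of_int (k y j) \<or> real_of_int (k y j) + 1 \<le> of_int (k x j)"
          using j(2) by linarith
        have "X x j - of_int (k x j) \<le> \<eta> \<or> of_int (k x j) + 1 - X x j \<le> \<eta>"
          "X y j - of_int (k y j) \<le> \<eta> \<or> of_int (k y j) + 1 - X y j \<le> \<eta>"
          using kk Xk[OF j(1), of x] Xk[OF j(1), of y] XY[OF j(1)] by (auto simp: abs_le_iff)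
        then show "1 - 4 * \<eta> \<le> g x" "1 - 4 * \<eta> \<le> g y"
          using gauge_near_wall[where k = "k x" and h = "H x" and x = "X x", OF d H[OF x] j(1) Xk[OF j(1)], of \<eta>]
            gauge_near_wall[where k = "k y" and h = "H y" and x = "X y", OF d H[OF y] j(1) Xk[OF j(1)], of \<eta>] unfolding g_def by blast+
      qed
      have "\<bar>z x i - X x i\<bar> \<le> 4 * \<eta>" "\<bar>z y i - X y i\<bar> \<le> 4 * \<eta>"
        using disp[OF x i] disp[OF y i] gap by linarith+
      then show ?thesis using XY[OF i] \<eta>\<delta> by linarith
    qed
  qed
  define col where "col = (\<lambda>x. skeleton_colour d \<delta> (z x) - 1)"
  define lab where "lab = (\<lambda>x. skeleton_label d \<delta> (z x))"
  have colour: "skeleton_colour d \<delta> (z x) \<in> {1..d}" if x: "x \<in> G" for x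
  proof -
    obtain i m where "i < d" "z x i = of_int m" using wall[OF x] by blast
    then show ?thesis using skeleton_colour(1)[OF \<delta>(1)] by blast
  qed
  show thesis
  proof (rule that[of col lab])
    show "col x < d" if "x \<in> G" for x using colour[OF that] unfolding col_def by auto
    show "lab x \<in> sites d" for x unfolding lab_def skeleton_label_def sites_def by auto
    show "\<bar>2 * x i - int K * lab x i\<bar> \<le> 3 * int K" if x: "x \<in> G" and i: "i < d" for x i
    proof -
      have "\<bar>z x i - X x i\<bar> \<le> 1" using disp[OF x i] g\<sigma>[OF x] \<sigma>(1) by linarith
      moreover have "\<bar>2 * z x i - of_int (lab x i)\<bar> \<le> 1"
        unfolding lab_def by (rule skeleton_label_close[OF i])
      ultimately have "\<bar>2 * X x i - of_int (lab x i)\<bar> \<le> 3" by linarith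
      then have "real K * \<bar>2 * X x i - of_int (lab x i)\<bar> \<le> real K * 3" by (intro mult_left_mono) auto
      moreover have "real K * \<bar>2 * X x i - of_int (lab x i)\<bar> = \<bar>real K * (2 * X x i - of_int (lab x i))\<bar>"
        by (simp add: abs_mult)
      moreover have "real K * (2 * X x i - of_int (lab x i)) = of_int (2 * x i - int K * lab x i)"
        unfolding X_def using K0 by (simp add: algebra_simps)
      ultimately have "real_of_int \<bar>2 * x i - int K * lab x i\<bar> \<le> real_of_int (3 * int K)" by simp
      then show ?thesis by (simp only: of_int_le_iff)
    qed
    show "lab x = lab y" if x: "x \<in> G" and y: "y \<in> G"
      and xy: "\<And>i. i < d \<Longrightarrow> \<bar>x i - y i\<bar> \<le> int R" and c: "col x = col y" for x y
    proof -
      obtain i m where 1: "i < d" "z x i = of_int m" using wall[OF x] by blast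
      obtain i' m' where 2: "i' < d" "z y i' = of_int m'" using wall[OF y] by blast
      have "skeleton_colour d \<delta> (z x) = skeleton_colour d \<delta> (z y)"
        using c colour[OF x] colour[OF y] unfolding col_def by auto
      then show ?thesis unfolding lab_def
        using skeleton_label_eq[where z = "z x" and z' = "z y", OF \<delta> 1 2 near[OF x y _ xy]] by blast
    qed
  qed
qed

section \<open>Equal dimensions\<close>

definition embed_grid :: "nat \<Rightarrow> (nat \<Rightarrow> nat) \<Rightarrow> nat \<Rightarrow> int" where
  "embed_grid d x = (\<lambda>i\<in>{..<d}. int (x i))"

lemma embed_grid_sites: "embed_grid d x \<in> sites d"
  unfolding embed_grid_def sites_def by auto

lemma l1_norm_embed_grid_le:
  assumes "sup_close d k x y"
  shows "l1_norm d (\<lambda>i. embed_grid d x i - embed_grid d y i) \<le> int (d * k)"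
proof -
  have "l1_norm d (\<lambda>i. embed_grid d x i - embed_grid d y i) \<le> (\<Sum>i<d. int k)"
    unfolding l1_norm_def
  proof (rule sum_mono)
    fix i assume i: "i \<in> {..<d}"
    then have "x i \<le> y i + k \<and> y i \<le> x i + k" using assms unfolding sup_close_def by auto
    then have "\<bar>int (x i) - int (y i)\<bar> \<le> int k" by linarith
    then show "\<bar>embed_grid d x i - embed_grid d y i\<bar> \<le> int k"
      using i unfolding embed_grid_def by simp
  qed
  then show ?thesis by simp
qed

text \<open>
  A jump of length 2 in the box has length at most \<open>2 d\<close> in the norm \<open>l1_norm\<close>, hence is mapped to a jump
  of length at most \<open>2 d M\<close>, which is the value of \<open>R\<close> for the colouring. The box has been chosen so large that
  a crossing contains more sites, one for each pair of successive levels, than a component can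
  accommodate.
\<close>

lemma no_embedding_among_holes:
  fixes d M K :: nat and h :: "(nat \<Rightarrow> int) \<Rightarrow> nat \<Rightarrow> int"
  defines "r \<equiv> 36 * d * (2 * d * M)" and "n \<equiv> 2 * (3 * K + 1) ^ d + 2"
  assumes d: "0 < d" and M: "0 < M" and K: "r \<le> K"
    and f: "f \<in> embeddings d d M \<omega>"
    and centre: "\<And>x i. x \<in> cube d (f (origin d)) (M * (d * n)) \<Longrightarrow> i < d \<Longrightarrow>
      int K \<le> 4 * (h (cube_index d K x) i - int K * cube_index d K x i) \<and>
      4 * (h (cube_index d K x) i - int K * cube_index d K x i) \<le> 3 * int K"
    and closed: "\<And>x y. x \<in> cube d (f (origin d)) (M * (d * n)) \<Longrightarrow>
      y \<in> cube d (h (cube_index d K x)) r \<Longrightarrow> \<not> \<omega> y"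
  shows False
proof -
  have f: "lip d d M f" "inj_on f (sites d)" "f ` sites d \<subseteq> open_sites d \<omega>"
    using f unfolding embeddings_def by auto
  define v where "v = f (origin d)"
  define G where "G = {x \<in> cube d v (M * (d * n)). \<omega> x}"
  define F where "F = (\<lambda>x. f (embed_grid d x))"
  have F_lip: "l1_norm d (\<lambda>i. F x i - F y i) \<le> int (M * (d * k))" if "sup_close d k x y" for x y k
  proof -
    have "l1_norm d (\<lambda>i. F x i - F y i)
        \<le> int M * l1_norm d (\<lambda>i. embed_grid d x i - embed_grid d y i)"
      unfolding F_def by (rule lip_bound[OF f(1) embed_grid_sites embed_grid_sites])
    also have "\<dots> \<le> int M * int (d * k)"
      using l1_norm_embed_grid_le[OF that] by (intro mult_left_mono) auto
    finally show ?thesis by simp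
  qed
  have o: "origin d = embed_grid d (\<lambda>_. 0)" unfolding origin_def embed_grid_def by simp
  have Fs: "F x \<in> sites d" "\<omega> (F x)" for x
    using f(3) embed_grid_sites unfolding F_def open_sites_def by auto
  have FG: "F x \<in> G" if x: "x \<in> grid d n" for x
  proof -
    have "sup_close d n x (\<lambda>_. 0)" using x unfolding grid_def sup_close_def by auto
    then have "l1_norm d (\<lambda>i. F x i - v i) \<le> int (M * (d * n))"
      using F_lip[of n x "\<lambda>_. 0"] unfolding v_def o F_def by simp
    then show ?thesis unfolding G_def using Fs in_cubeI_l1 by blast
  qed
  have R: "0 < 2 * d * M" using d M by simp
  have hole: "\<exists>i<d. int (36 * d * (2 * d * M)) < \<bar>x i - h (cube_index d K x) i\<bar>" if "x \<in> G" for x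
  proof (rule ccontr)
    assume "\<not> ?thesis"
    then have "x i \<in> {h (cube_index d K x) i - int r .. h (cube_index d K x) i + int r}" if "i < d" for i
      using that unfolding r_def by (fastforce simp: not_less abs_le_iff)
    moreover have "x \<in> sites d" using \<open>x \<in> G\<close> unfolding G_def cube_def sites_def by (auto simp: PiE_iff)
    ultimately have "x \<in> cube d (h (cube_index d K x)) r"
      unfolding cube_def sites_def by (auto simp: PiE_iff)
    then show False using closed \<open>x \<in> G\<close> unfolding G_def v_def by auto
  qed
  have centre': "int K \<le> 4 * (h (cube_index d K x) i - int K * cube_index d K x i) \<and>
      4 * (h (cube_index d K x) i - int K * cube_index d K x i) \<le> 3 * int K" if "x \<in> G" "i < d" for x i
    using centre[of x i] that unfolding G_def v_def by blast
  obtain col :: "(nat \<Rightarrow> int) \<Rightarrow> nat" and lab :: "(nat \<Rightarrow> int) \<Rightarrow> nat \<Rightarrow> int" where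
    col: "\<And>x. x \<in> G \<Longrightarrow> col x < d"
    and lab_close: "\<And>x i. x \<in> G \<Longrightarrow> i < d \<Longrightarrow> \<bar>2 * x i - int K * lab x i\<bar> \<le> 3 * int K"
    and lab_sites: "\<And>x. lab x \<in> sites d"
    and lab_eq: "\<And>x y. x \<in> G \<Longrightarrow> y \<in> G \<Longrightarrow> (\<And>i. i < d \<Longrightarrow> \<bar>x i - y i\<bar> \<le> int (2 * d * M)) \<Longrightarrow>
       col x = col y \<Longrightarrow> lab x = lab y"
    using perforated_lattice_colouring[OF d R K[unfolded r_def] centre' hole, of G] by blast
  have n0: "0 < n" unfolding n_def by simp
  obtain c i where i: "i < d"
    and c: "\<And>t. 1 \<le> t \<Longrightarrow> t < n \<Longrightarrow> \<exists>x\<in>grid d n. lab (F x) = c \<and> (x i = t \<or> x i = t + 1)"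
  proof -
    have "\<exists>c. \<exists>i<d. \<forall>t. 1 \<le> t \<longrightarrow> t < n \<longrightarrow>
      (\<exists>x\<in>grid d n. lab (F x) = c \<and> (x i = t \<or> x i = t + 1))"
    proof (rule long_component[OF n0])
      show "col (F x) < d" if "x \<in> grid d n" for x using col[OF FG[OF that]] .
      show "lab (F x) = lab (F y)"
        if "x \<in> grid d n" "y \<in> grid d n" "sup_close d 2 x y" "col (F x) = col (F y)" for x y
      proof (rule lab_eq[OF FG[OF that(1)] FG[OF that(2)] _ that(4)])
        fix i assume "i < d"
        then show "\<bar>F x i - F y i\<bar> \<le> int (2 * d * M)"
          using l1_norm_component_le[of i d "\<lambda>i. F x i - F y i"] F_lip[OF that(3)]
          by (simp add: mult_ac)
      qed
    qed
    then show thesis using that by blast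
  qed
  define N where "N = (3 * K + 1) ^ d"
  define S where "S = {y \<in> G. lab y = c}"
  have "finite S \<and> card S \<le> N"
  proof -
    \<comment> \<open>The lowest coordinates that are compatible with the label \<open>c\<close>.\<close>
    define a where "a = (\<lambda>i. (int K * c i - 3 * int K + 1) div 2)"
    let ?P = "\<Pi>\<^sub>E i\<in>{..<d}. {a i .. a i + 3 * int K}"
    have "S \<subseteq> ?P"
    proof
      fix y assume y: "y \<in> S"
      have "y i \<in> {a i .. a i + 3 * int K}" if "i < d" for i
      proof -
        have "\<bar>2 * y i - int K * c i\<bar> \<le> 3 * int K" using lab_close[of y i] y that unfolding S_def by auto
        then show ?thesis unfolding a_def by auto
      qed
      moreover have "y \<in> extensional {..<d}" using y unfolding S_def G_def cube_def by (auto simp: PiE_iff)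
      ultimately show "y \<in> ?P" by (auto simp: PiE_iff)
    qed
    moreover have "finite ?P" by (auto intro: finite_PiE)
    moreover have "card ?P = N" unfolding N_def
      by (subst card_PiE) (auto simp: nat_add_distrib nat_mult_distrib)
    ultimately show ?thesis using card_mono finite_subset by metis
  qed
  moreover have "N + 1 \<le> card S"
  proof -
    have "\<exists>x. x \<in> grid d n \<and> lab (F x) = c \<and> (x i = 2 * s + 1 \<or> x i = 2 * s + 2)" if "s < N + 1" for s
      using c[of "2 * s + 1"] that unfolding n_def N_def[symmetric] by auto
    then obtain x where x: "\<And>s. s < N + 1 \<Longrightarrow> x s \<in> grid d n \<and> lab (F (x s)) = c \<and>
        (x s i = 2 * s + 1 \<or> x s i = 2 * s + 2)" by metis
    \<comment> \<open>The levels of the chosen sites are different, hence so are the sites and their images.\<close>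
    have "inj_on (\<lambda>s. F (x s)) {..<N + 1}"
    proof (rule inj_onI)
      fix s t assume st: "s \<in> {..<N + 1}" "t \<in> {..<N + 1}" "F (x s) = F (x t)"
      then have "embed_grid d (x s) = embed_grid d (x t)"
        using inj_onD[OF f(2) _ embed_grid_sites embed_grid_sites] unfolding F_def by blast
      then have "embed_grid d (x s) i = embed_grid d (x t) i" by simp
      then have "x s i = x t i" using i unfolding embed_grid_def by simp
      then show "s = t" using x[of s] x[of t] st by (auto; presburger)
    qed
    moreover have "(\<lambda>s. F (x s)) ` {..<N + 1} \<subseteq> S" using x FG unfolding S_def by auto
    ultimately have "card {..<N + 1} \<le> card S"
      using \<open>finite S \<and> card S \<le> N\<close> by (intro card_inj_on_le) auto
    then show ?thesis by simp
  qed
  ultimately show False by simp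
qed

text \<open>
  Each cube has side \<open>K = 4 w m\<close>, where \<open>w = 2 r + 1\<close> is the width of a hole, and has \<open>m\<close> disjoint
  candidates for a hole, lined up in the direction of the first coordinate in the middle half of
  the cube. All of them fail with probability \<open>\<theta> ^ m\<close>, and polynomially many cubes matter.
\<close>

lemma lip_prob_eq_0_equal_dims:
  assumes d: "0 < d" and M: "0 < M" and p: "0 \<le> p" "p < 1"
  shows "lip_prob d d M p = 0"
proof -
  define r where "r = 36 * d * (2 * d * M)"
  define w where "w = 2 * r + 1"
  define \<theta> where "\<theta> = 1 - (1 - p) ^ (w ^ d)"
  have \<theta>: "0 \<le> \<theta>" "\<theta> < 1" unfolding \<theta>_def using p by (auto simp: power_le_one)
  define K where "K = (\<lambda>m. 4 * w * m)"
  define n where "n = (\<lambda>m. 2 * (3 * K m + 1) ^ d + 2)"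
  \<comment> \<open>The centre of the \<open>j\<close>-th candidate in the cube with index \<open>k\<close>.\<close>
  define centre where "centre = (\<lambda>m (k :: nat \<Rightarrow> int) j i.
    int (K m) * k i + (if i = 0 then int (w * m + w * j) else int (2 * w * m)))"
  define H where "H = (\<lambda>m k j. cube d (centre m k j) r)"
  define I where "I = (\<lambda>m v. cube_index d (K m) ` cube d v (M * (d * n m)))"
  define B where "B = (\<lambda>m k. {\<omega> \<in> space (percolation d p). \<forall>j<m. \<exists>x\<in>H m k j. \<omega> x})"
  define U where "U = (\<lambda>v m. \<Union>k\<in>I m v. B m k)"
  interpret P: prob_space "percolation d p" by (rule prob_space_percolation)
  have finI: "finite (I m v)" and cardI: "card (I m v) \<le> (2 * (M * (d * n m)) + 1) ^ d" for m v
  proof -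
    show "finite (I m v)" unfolding I_def by (intro finite_imageI finite_cube)
    have "card (I m v) \<le> card (cube d v (M * (d * n m)))"
      unfolding I_def by (rule card_image_le[OF finite_cube])
    then show "card (I m v) \<le> (2 * (M * (d * n m)) + 1) ^ d" unfolding card_cube .
  qed
  have disj: "disjoint_family_on (H m k) {..<m}" for m k
    unfolding disjoint_family_on_def
  proof (intro ballI impI)
    fix j j' :: nat assume ne: "j \<noteq> j'"
    show "H m k j \<inter> H m k j' = {}"
    proof (rule ccontr)
      assume "H m k j \<inter> H m k j' \<noteq> {}"
      then obtain x where "x \<in> H m k j" "x \<in> H m k j'" by auto
      then have "x 0 \<in> {centre m k j 0 - int r .. centre m k j 0 + int r}"
        "x 0 \<in> {centre m k j' 0 - int r .. centre m k j' 0 + int r}"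
        using d unfolding H_def cube_def by (auto simp: PiE_iff)
      then have "\<bar>int w * int j - int w * int j'\<bar> \<le> 2 * int r" unfolding centre_def by auto
      then have "int w * \<bar>int j - int j'\<bar> \<le> 2 * int r"
        unfolding right_diff_distrib[symmetric] abs_mult by simp
      moreover have "int w * 1 \<le> int w * \<bar>int j - int j'\<bar>"
        using ne by (intro mult_left_mono) auto
      moreover have "int w = 2 * int r + 1" unfolding w_def by simp
      ultimately show False by linarith
    qed
  qed
  have H: "H m k j \<subseteq> sites d \<and> finite (H m k j) \<and> card (H m k j) = w ^ d \<and> {} \<inter> H m k j = {}" for m k j
    unfolding H_def w_def using finite_cube card_cube by (auto simp: cube_def sites_def PiE_iff)
  have B: "B m k \<in> sets (percolation d p)" "measure (percolation d p) (B m k) = \<theta> ^ m" for m k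
  proof -
    have p': "p \<in> {0..1}" using p by simp
    have "B m k = {\<omega> \<in> space (percolation d p). (\<forall>x\<in>{}. \<not> \<omega> x) \<and> (\<forall>j<m. \<exists>x\<in>H m k j. \<omega> x)}"
      unfolding B_def by simp
    note B_eq = this
    note hole = prob_closed_and_no_hole[of p "{}" d m "H m k" "w ^ d",
        OF p' empty_subsetI finite.emptyI H disj, folded B_eq]
    show "B m k \<in> sets (percolation d p)" by (rule hole(1))
    show "measure (percolation d p) (B m k) = \<theta> ^ m"
      using hole(2) by (simp only: \<theta>_def card.empty power_0 mult_1)
  qed
  show ?thesis
  proof (rule lip_prob_eq_0I[where U = "\<lambda>v m. U v (Suc m)"])
    show "U v (Suc m) \<in> sets (percolation d p)" for v m
      unfolding U_def using finI by (intro sets.finite_UN B(1))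
    show "measure (percolation d p) (U v (Suc m)) \<le> (2 * (M * (d * n (Suc m))) + 1) ^ d * \<theta> ^ Suc m" for v m
    proof -
      let ?m = "Suc m"
      have "P.prob (U v ?m) \<le> (\<Sum>k\<in>I ?m v. P.prob (B ?m k))"
        unfolding U_def using finI B(1) by (intro P.finite_measure_subadditive_finite) auto
      also have "\<dots> = (\<Sum>k\<in>I ?m v. \<theta> ^ ?m)" using B(2) by (intro sum.cong refl)
      also have "\<dots> = real (card (I ?m v)) * \<theta> ^ ?m" by simp
      also have "\<dots> \<le> real ((2 * (M * (d * n ?m)) + 1) ^ d) * \<theta> ^ ?m"
        using \<theta> cardI[of ?m v] by (intro mult_right_mono of_nat_mono) auto
      finally show ?thesis by simp
    qed
    show "(\<lambda>m. real ((2 * (M * (d * n (Suc m))) + 1) ^ d) * \<theta> ^ Suc m) \<longlonglongrightarrow> 0"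
    proof -
      define C where "C = real (3 * (M * (d * (4 * (13 * w) ^ d))))"
      have bound: "real ((2 * (M * (d * n m)) + 1) ^ d) \<le> C ^ d * real m ^ (d * d)" if "0 < m" for m
      proof -
        have "1 \<le> w * m" unfolding w_def using that by simp
        then have "3 * K m + 1 \<le> 13 * w * m" unfolding K_def by simp
        then have 1: "(3 * K m + 1) ^ d \<le> (13 * w * m) ^ d" by (rule power_mono) simp
        have "1 \<le> (3 * K m + 1) ^ d" by simp
        then have 2: "n m \<le> 4 * (13 * w * m) ^ d" using 1 unfolding n_def by linarith
        have "1 \<le> M * (d * n m)" using M d unfolding n_def by simp
        then have "2 * (M * (d * n m)) + 1 \<le> 3 * (M * (d * n m))" by linarith
        also have "\<dots> \<le> 3 * (M * (d * (4 * (13 * w * m) ^ d)))" using 2 by (intro mult_left_mono) auto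
        also have "\<dots> = 3 * (M * (d * (4 * (13 * w) ^ d))) * m ^ d" by (simp add: power_mult_distrib mult_ac)
        finally have "(2 * (M * (d * n m)) + 1) ^ d \<le> (3 * (M * (d * (4 * (13 * w) ^ d))) * m ^ d) ^ d"
          by (rule power_mono) simp
        then have "real ((2 * (M * (d * n m)) + 1) ^ d) \<le> real ((3 * (M * (d * (4 * (13 * w) ^ d))) * m ^ d) ^ d)"
          by (rule of_nat_mono)
        also have "\<dots> = C ^ d * real m ^ (d * d)"
          unfolding C_def by (simp only: of_nat_power of_nat_mult power_mult_distrib power_mult)
        finally show ?thesis .
      qed
      have "(\<lambda>m. C ^ d * (real (Suc m) ^ (d * d) * \<theta> ^ Suc m)) \<longlonglongrightarrow> C ^ d * 0"
        by (intro tendsto_mult tendsto_const LIMSEQ_Suc poly_times_geometric_tendsto_0 \<theta>)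
      then have lim: "(\<lambda>m. C ^ d * (real (Suc m) ^ (d * d) * \<theta> ^ Suc m)) \<longlonglongrightarrow> 0" by simp
      show ?thesis
      proof (rule tendsto_sandwich[OF _ _ tendsto_const lim])
        show "\<forall>\<^sub>F m in sequentially. 0 \<le> real ((2 * (M * (d * n (Suc m))) + 1) ^ d) * \<theta> ^ Suc m"
          using \<theta>(1) by (intro always_eventually allI mult_nonneg_nonneg zero_le_power of_nat_0_le_iff)
        have "real ((2 * (M * (d * n (Suc m))) + 1) ^ d) * \<theta> ^ Suc m
          \<le> C ^ d * (real (Suc m) ^ (d * d) * \<theta> ^ Suc m)" for m
          using mult_right_mono[OF bound[of "Suc m"] zero_le_power[OF \<theta>(1), of "Suc m"]]
          by (simp only: mult.assoc zero_less_Suc)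
        then show "\<forall>\<^sub>F m in sequentially. real ((2 * (M * (d * n (Suc m))) + 1) ^ d) * \<theta> ^ Suc m
          \<le> C ^ d * (real (Suc m) ^ (d * d) * \<theta> ^ Suc m)" by (intro always_eventually allI)
      qed
    qed
    show "\<omega> \<in> U (f (origin d)) (Suc m')"
      if \<omega>: "\<omega> \<in> space (percolation d p)" and f: "f \<in> embeddings d d M \<omega>" for \<omega> f m'
    proof (rule ccontr)
      define m where "m = Suc m'"
      assume "\<omega> \<notin> U (f (origin d)) (Suc m')"
      then have "\<exists>j<m. \<forall>x\<in>H m k j. \<not> \<omega> x" if "k \<in> I m (f (origin d))" for k
        using \<omega> that unfolding U_def B_def m_def[symmetric] by auto
      then obtain j where j: "\<And>k. k \<in> I m (f (origin d)) \<Longrightarrow> j k < m \<and> (\<forall>x\<in>H m k (j k). \<not> \<omega> x)"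
        by metis
      have wm: "1 \<le> m" unfolding m_def by simp
      show False
      proof (rule no_embedding_among_holes[OF d M _ f, where K = "K m" and h = "\<lambda>k. centre m k (j k)"])
        have "r \<le> w * 1" unfolding w_def by simp
        also have "\<dots> \<le> w * m" using wm by (intro mult_left_mono) auto
        finally show "36 * d * (2 * d * M) \<le> K m" unfolding K_def r_def[symmetric] by simp
      next
        fix x i
        assume x: "x \<in> cube d (f (origin d)) (M * (d * (2 * (3 * K m + 1) ^ d + 2)))" and i: "i < d"
        define k where "k = cube_index d (K m) x"
        have "k \<in> I m (f (origin d))" unfolding I_def k_def n_def using x by blast
        then have "j k < m" using j by blast
        then have "int (w * j k) \<le> int (w * m)" by (intro of_nat_mono mult_left_mono) auto
        then have "int (w * m) \<le> (if i = 0 then int (w * m) + int (w * j k) else 2 * int (w * m))"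
          "(if i = 0 then int (w * m) + int (w * j k) else 2 * int (w * m)) \<le> 2 * int (w * m)"
          by (auto simp del: of_nat_mult)
        moreover define q where "q = centre m k (j k) i - int (K m) * k i"
        moreover have "q
            = (if i = 0 then int (w * m) + int (w * j k) else 2 * int (w * m))"
          unfolding q_def centre_def by simp
        moreover have "int (K m) = 4 * int (w * m)" unfolding K_def by simp
        ultimately show "int (K m) \<le> 4 * (centre m (cube_index d (K m) x) (j (cube_index d (K m) x)) i
            - int (K m) * cube_index d (K m) x i) \<and>
          4 * (centre m (cube_index d (K m) x) (j (cube_index d (K m) x)) i
            - int (K m) * cube_index d (K m) x i) \<le> 3 * int (K m)"
          unfolding k_def[symmetric] q_def[symmetric] by linarith
      next
        fix x y
        assume x: "x \<in> cube d (f (origin d)) (M * (d * (2 * (3 * K m + 1) ^ d + 2)))"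
          and y: "y \<in> cube d (centre m (cube_index d (K m) x) (j (cube_index d (K m) x))) (36 * d * (2 * d * M))"
        have "cube_index d (K m) x \<in> I m (f (origin d))" unfolding I_def n_def using x by blast
        then show "\<not> \<omega> y" using j y unfolding H_def r_def by blast
      qed
    qed
  qed
qed

section \<open>Critical values\<close>

text \<open>
  For \<open>p = 1\<close> the lattice embeds by padding with zeros; this keeps the infimum that defines the critical
  probability from being infinite.
\<close>

lemma lip_prob_eq_1_all_open:
  assumes "d \<le> D" "1 \<le> M"
  shows "lip_prob d D M 1 = 1"
proof -
  interpret P: prob_space "percolation D 1" by (rule prob_space_percolation)
  have "AE \<omega> in percolation D 1. \<omega> x" if "x \<in> sites D" for x
  proof -
    have "P.prob {\<omega> \<in> space (percolation D 1). \<forall>y\<in>{x}. \<omega> y = True} = 1"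
      using prob_all_equal[of 1 "{x}" D True] that by simp
    then have "P.prob {\<omega> \<in> space (percolation D 1). \<omega> x} = 1" by simp
    then show ?thesis
      using P.prob_Collect_eq_1[of "\<lambda>\<omega>. \<omega> x"] percolation_event_measurable[OF that, of 1 True] by simp
  qed
  then have all_open: "AE \<omega> in percolation D 1. \<forall>x\<in>sites D. \<omega> x"
    using countable_sites by (simp add: AE_ball_countable)
  have emb: "embeddings d D M \<omega> \<noteq> {}" if \<omega>: "\<forall>x\<in>sites D. \<omega> x" for \<omega>
  proof -
    define f :: "(nat \<Rightarrow> int) \<Rightarrow> nat \<Rightarrow> int" where
      "f = (\<lambda>x. \<lambda>i\<in>{..<D}. if i < d then x i else 0)"
    have fs: "f x \<in> sites D" for x unfolding f_def sites_def by auto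
    have "l1_norm D (\<lambda>i. f x i - f y i) = l1_norm d (\<lambda>i. x i - y i)" for x y
    proof -
      have "l1_norm D (\<lambda>i. f x i - f y i) = (\<Sum>i<D. if i < d then \<bar>x i - y i\<bar> else 0)"
        unfolding l1_norm_def f_def by (intro sum.cong) auto
      also have "\<dots> = (\<Sum>i\<in>{..<D} \<inter> {i. i < d}. \<bar>x i - y i\<bar>)" by (subst sum.inter_restrict) auto
      also have "{..<D} \<inter> {i. i < d} = {..<d}" using assms(1) by auto
      finally show ?thesis unfolding l1_norm_def .
    qed
    then have "lip d D M f" unfolding lip_def using fs assms(2) by auto
    moreover have "inj_on f (sites d)"
    proof (rule inj_onI)
      fix x y assume xy: "x \<in> sites d" "y \<in> sites d" "f x = f y"
      have "x i = y i" if "i < d" for i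
        using fun_cong[OF xy(3), of i] that assms(1) unfolding f_def by simp
      then show "x = y" using xy(1,2) by (intro sites_eqI)
    qed
    ultimately have "f \<in> embeddings d D M \<omega>"
      using fs \<omega> unfolding embeddings_def open_sites_def by auto
    then show ?thesis by auto
  qed
  have "AE \<omega> in percolation D 1. embeddings d D M \<omega> \<noteq> {}"
    using all_open by (rule AE_mp) (intro AE_I2 impI emb)
  then show ?thesis
    unfolding lip_prob_eq using P.prob_Collect_eq_1[OF embedding_event_measurable] by simp
qed

lemma p_crit_eq_1:
  assumes "d \<le> D" "1 \<le> M" and "\<And>p. 0 \<le> p \<Longrightarrow> p < 1 \<Longrightarrow> lip_prob d D M p = 0"
  shows "p_crit d D M = 1"
proof -
  have "{p \<in> {0..1}. lip_prob d D M p = 1} = {1}"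
    using lip_prob_eq_1_all_open[OF assms(1,2)] assms(3) by (force simp: order.order_iff_strict)
  then show ?thesis unfolding p_crit_def by simp
qed

theorem theorem1:
  "(\<forall>d\<ge>1. p_crit d (d + 1) 2 < 1 \<and> M_crit d (d + 1) \<le> 2) \<and>
   (\<forall>D\<ge>2. p_crit 2 D 1 = 1 \<and> M_crit 2 D > 1) \<and>
   (\<forall>d\<ge>2. (\<forall>M\<ge>1. p_crit d d M = 1) \<and> M_crit d d = \<infinity>)"
proof (intro conjI allI impI)
  fix d :: nat
  obtain p where p: "0 \<le> p" "p < 1" "lip_prob d (d + 1) 2 p = 1"
    using lip_prob_eq_1_codim_1[of d] by auto
  have "p_crit d (d + 1) 2 \<le> ereal p"
    unfolding p_crit_def using p by (intro INF_lower) auto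
  also have "ereal p < 1" using p(2) by simp
  finally show less: "p_crit d (d + 1) 2 < 1" .
  have "M_crit d (d + 1) \<le> enat 2"
    unfolding M_crit_def using less by (intro INF_lower) auto
  then show "M_crit d (d + 1) \<le> 2" by (simp add: numeral_eq_enat)
next
  fix D :: nat
  assume D: "2 \<le> D"
  show one: "p_crit 2 D 1 = 1"
    using D lip_prob_eq_0_plane by (intro p_crit_eq_1) auto
  have "2 \<le> M_crit 2 D"
    unfolding M_crit_def
  proof (rule INF_greatest)
    fix M assume "M \<in> {M. 1 \<le> M \<and> p_crit 2 D M < 1}"
    then have "M \<noteq> 1" "1 \<le> M" using one by auto
    then show "2 \<le> enat M" by (simp add: numeral_eq_enat)
  qed
  then show "1 < M_crit 2 D"
    by (rule less_le_trans[rotated]) (simp add: numeral_eq_enat one_enat_def)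
next
  fix d :: nat
  assume d: "2 \<le> d"
  have one: "p_crit d d M = 1" if "1 \<le> M" for M
    using d that lip_prob_eq_0_equal_dims by (intro p_crit_eq_1) auto
  then show "p_crit d d M = 1" if "1 \<le> M" for M using that .
  have "{M. 1 \<le> M \<and> p_crit d d M < 1} = {}" using one by fastforce
  then show "M_crit d d = \<infinity>" unfolding M_crit_def by (simp only: image_empty Inf_empty top_enat_def)
qed

end
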